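(* Let $G$ be a non-Archimedean locally compact abelian group. For any compact open subset $\Omega\subset G$, there exists a set $\Lambda\subset\widehat{G}$ of characters which forms a Riesz basis of $L^2(\Omega)$.
   Context: All groups are Polish (separable and completely metrizable). A locally compact abelian group is an abelian topological group whose topology is Hausdorff and in which every point has a compact neighborhood. A Polish group is non-Archimedean if it admits a compatible left-invariant ultrametric (equivalently, the identity has a neighborhood basis consisting of open subgroups). $\widehat{G}$ is the group of characters of $G$, i.e. continuous group homomorphisms $G\to\mathbb{T}=\{z\in\mathbb{C}:|z|=1\}$. $L^2(\Omega)$ is taken with respect to Haar measure $\mu$ of $G$ restricted to $\Omega$. A countable (finite or infinite) family $\{f_n\}$ in a separable Hilbert space $\mathcal{H}$ is a Riesz basis if $f_n=Te_n$ for all $n$, for some bounded invertible operator $T:\mathcal{H}\to\mathcal{H}$ and some orthonormal basis $\{e_n\}$ of $\mathcal{H}$; equivalently, $\{f_n\}$ is complete in $\mathcal{H}$ and there is $K>0$ with $\frac1K\sum_n|a_n|^2\le\|\sum_n a_nf_n\|^2\le K\sum_n|a_n|^2$ for all square-summable $\{a_n\}\subset\mathbb{C}$. A set $\Lambda\subset\widehat{G}$ forms a Riesz basis of $L^2(\Omega)$ if the family of restrictions to $\Omega$ of the characters in $\Lambda$ (indexed by $\Lambda$) is a Riesz basis of $L^2(\Omega)$. *)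

theory Defs
  imports "HOL-Analysis.Analysis"
begin

section \<open>Topological groups\<close>

text \<open>The topology of the group is that of its type (\<^const>\<open>euclidean\<close> is the
  topology given by \<^term>\<open>open\<close>); no metric is distinguished. Continuity of the group operations
  is part of the class \<^class>\<open>topological_ab_group_add\<close>.\<close>

definition polish_group :: "'a::topological_ab_group_add itself \<Rightarrow> bool" where
  "polish_group _ \<longleftrightarrow>
     separable_space (euclidean :: 'a topology) \<and>
     completely_metrizable_space (euclidean :: 'a topology)"

definition locally_compact_abelian_group :: "'a::topological_ab_group_add itself \<Rightarrow> bool" where
  "locally_compact_abelian_group _ \<longleftrightarrow>
     Hausdorff_space (euclidean :: 'a topology) \<and>
     locally_compact_space (euclidean :: 'a topology)"

definition non_archimedean_group :: "'a::topological_ab_group_add itself \<Rightarrow> bool" where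
  "non_archimedean_group _ \<longleftrightarrow>
     (\<exists>d :: 'a \<Rightarrow> 'a \<Rightarrow> real.
        Metric_space UNIV d \<and>
        Metric_space.mtopology UNIV d = euclidean \<and>
        (\<forall>x y z. d x z \<le> max (d x y) (d y z)) \<and>
        (\<forall>g x y. d (g + x) (g + y) = d x y))"

definition characters :: "('a::topological_ab_group_add \<Rightarrow> complex) set" where
  "characters = {\<gamma>. continuous_on UNIV \<gamma> \<and> (\<forall>x. \<gamma> x \<in> sphere 0 1) \<and>
                     (\<forall>x y. \<gamma> (x + y) = \<gamma> x * \<gamma> y)}"

text \<open>A Haar measure is a nonzero translation-invariant Radon measure on the Borel sets.\<close>

definition haar_measure :: "'a::topological_ab_group_add measure \<Rightarrow> bool" where
  "haar_measure \<mu> \<longleftrightarrow>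
     sets \<mu> = sets borel \<and>
     emeasure \<mu> UNIV \<noteq> 0 \<and>
     (\<forall>g. \<forall>A\<in>sets borel. emeasure \<mu> ((+) g ` A) = emeasure \<mu> A) \<and>
     (\<forall>K. compact K \<longrightarrow> emeasure \<mu> K < \<infinity>) \<and>
     (\<forall>A\<in>sets borel. emeasure \<mu> A = (INF U\<in>{U. open U \<and> A \<subseteq> U}. emeasure \<mu> U)) \<and>
     (\<forall>U. open U \<longrightarrow> emeasure \<mu> U = (SUP K\<in>{K. compact K \<and> K \<subseteq> U}. emeasure \<mu> K))"


section \<open>Riesz bases\<close>

text \<open>Complex vector spaces with inner product are represented by explicit carriers, since
  \<open>L\<^sup>2\<close> depends on a measure. The notions below are meant for records that are Hilbert spaces.\<close>

record 'v inner_space =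
  vecs :: "'v set"
  vzero :: 'v
  vadd :: "'v \<Rightarrow> 'v \<Rightarrow> 'v"
  vscale :: "complex \<Rightarrow> 'v \<Rightarrow> 'v"
  vinner :: "'v \<Rightarrow> 'v \<Rightarrow> complex"

definition vnorm :: "('v, 'm) inner_space_scheme \<Rightarrow> 'v \<Rightarrow> real" where
  "vnorm H x = sqrt (Re (vinner H x x))"

definition vdist :: "('v, 'm) inner_space_scheme \<Rightarrow> 'v \<Rightarrow> 'v \<Rightarrow> real" where
  "vdist H x y = vnorm H (vadd H x (vscale H (-1) y))"

inductive_set vspan :: "('v, 'm) inner_space_scheme \<Rightarrow> 'v set \<Rightarrow> 'v set"
  for H :: "('v, 'm) inner_space_scheme" and S :: "'v set" where
  zero: "vzero H \<in> vspan H S"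
| base: "x \<in> S \<Longrightarrow> x \<in> vspan H S"
| add: "x \<in> vspan H S \<Longrightarrow> y \<in> vspan H S \<Longrightarrow> vadd H x y \<in> vspan H S"
| scale: "x \<in> vspan H S \<Longrightarrow> vscale H c x \<in> vspan H S"

definition orthonormal_basis :: "('v, 'm) inner_space_scheme \<Rightarrow> 'i set \<Rightarrow> ('i \<Rightarrow> 'v) \<Rightarrow> bool" where
  "orthonormal_basis H I e \<longleftrightarrow>
     e ` I \<subseteq> vecs H \<and>
     (\<forall>i\<in>I. \<forall>j\<in>I. vinner H (e i) (e j) = (if i = j then 1 else 0)) \<and>
     (\<forall>x\<in>vecs H. \<forall>\<epsilon>>0. \<exists>y\<in>vspan H (e ` I). vdist H x y < \<epsilon>)"

definition bounded_operator :: "('v, 'm) inner_space_scheme \<Rightarrow> ('v \<Rightarrow> 'v) \<Rightarrow> bool" where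
  "bounded_operator H T \<longleftrightarrow>
     T ` vecs H \<subseteq> vecs H \<and>
     (\<forall>x\<in>vecs H. \<forall>y\<in>vecs H. T (vadd H x y) = vadd H (T x) (T y)) \<and>
     (\<forall>c. \<forall>x\<in>vecs H. T (vscale H c x) = vscale H c (T x)) \<and>
     (\<exists>C. \<forall>x\<in>vecs H. vnorm H (T x) \<le> C * vnorm H x)"

definition bounded_invertible_operator :: "('v, 'm) inner_space_scheme \<Rightarrow> ('v \<Rightarrow> 'v) \<Rightarrow> bool" where
  "bounded_invertible_operator H T \<longleftrightarrow>
     bounded_operator H T \<and>
     (\<exists>S. bounded_operator H S \<and> (\<forall>x\<in>vecs H. S (T x) = x \<and> T (S x) = x))"

definition riesz_basis :: "('v, 'm) inner_space_scheme \<Rightarrow> 'i set \<Rightarrow> ('i \<Rightarrow> 'v) \<Rightarrow> bool" where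
  "riesz_basis H I f \<longleftrightarrow>
     countable I \<and>
     (\<exists>T e. bounded_invertible_operator H T \<and> orthonormal_basis H I e \<and> (\<forall>i\<in>I. f i = T (e i)))"


section \<open>The Hilbert space \<open>L\<^sup>2\<close>\<close>

definition square_integrable :: "'a measure \<Rightarrow> ('a \<Rightarrow> complex) set" where
  "square_integrable M = {f \<in> borel_measurable M. integrable M (\<lambda>x. (cmod (f x))\<^sup>2)}"

definition ae_eq :: "'a measure \<Rightarrow> (('a \<Rightarrow> complex) \<times> ('a \<Rightarrow> complex)) set" where
  "ae_eq M = {(f, g). f \<in> square_integrable M \<and> g \<in> square_integrable M \<and> (AE x in M. f x = g x)}"

definition L2_class :: "'a measure \<Rightarrow> ('a \<Rightarrow> complex) \<Rightarrow> ('a \<Rightarrow> complex) set" where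
  "L2_class M f = ae_eq M `` {f}"

text \<open>The operations are induced from representatives; well-definedness is proved in the
  lemmas below.\<close>

definition L2 :: "'a measure \<Rightarrow> ('a \<Rightarrow> complex) set inner_space" where
  "L2 M = \<lparr> vecs = square_integrable M // ae_eq M,
            vzero = L2_class M (\<lambda>x. 0),
            vadd = (\<lambda>A B. \<Union>f\<in>A. \<Union>g\<in>B. L2_class M (\<lambda>x. f x + g x)),
            vscale = (\<lambda>c A. \<Union>f\<in>A. L2_class M (\<lambda>x. c * f x)),
            vinner = (\<lambda>A B. the_elem (\<Union>f\<in>A. \<Union>g\<in>B. {\<integral>x. f x * cnj (g x) \<partial>M})) \<rparr>"

lemma square_integrable_add:
  assumes "f \<in> square_integrable M" "g \<in> square_integrable M"
  shows "(\<lambda>x. f x + g x) \<in> square_integrable M"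
proof -
  have m: "f \<in> borel_measurable M" "g \<in> borel_measurable M"
    and i: "integrable M (\<lambda>x. (cmod (f x))\<^sup>2)" "integrable M (\<lambda>x. (cmod (g x))\<^sup>2)"
    using assms by (auto simp: square_integrable_def)
  have le: "(cmod (a + b))\<^sup>2 \<le> 2 * (cmod a)\<^sup>2 + 2 * (cmod b)\<^sup>2" for a b :: complex
  proof -
    have "(cmod (a + b))\<^sup>2 \<le> (cmod a + cmod b)\<^sup>2"
      by (intro power_mono norm_triangle_ineq norm_ge_zero)
    also have "\<dots> \<le> 2 * (cmod a)\<^sup>2 + 2 * (cmod b)\<^sup>2"
      using zero_le_power2[of "cmod a - cmod b"] by (simp add: power2_eq_square algebra_simps)
    finally show ?thesis .
  qed
  have "integrable M (\<lambda>x. (cmod (f x + g x))\<^sup>2)"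
    by (rule Bochner_Integration.integrable_bound
          [where f = "\<lambda>x. 2 * (cmod (f x))\<^sup>2 + 2 * (cmod (g x))\<^sup>2"])
       (use m i le in auto)
  then show ?thesis using m by (auto simp: square_integrable_def)
qed

lemma square_integrable_scale:
  "f \<in> square_integrable M \<Longrightarrow> (\<lambda>x. c * f x) \<in> square_integrable M"
  by (auto simp: square_integrable_def norm_mult power_mult_distrib)

lemma equiv_ae_eq: "equiv (square_integrable M) (ae_eq M)"
proof (rule equivI)
  show "ae_eq M \<subseteq> square_integrable M \<times> square_integrable M"
    by (auto simp: ae_eq_def)
  show "refl_on (square_integrable M) (ae_eq M)"
    by (auto simp: refl_on_def ae_eq_def)
  show "sym (ae_eq M)"
    by (auto simp: sym_def ae_eq_def elim: eventually_mono)
  show "trans (ae_eq M)"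
  proof (rule transI)
    fix f g h assume "(f, g) \<in> ae_eq M" "(g, h) \<in> ae_eq M"
    then have *: "f \<in> square_integrable M" "h \<in> square_integrable M"
      and ae: "AE x in M. f x = g x" "AE x in M. g x = h x"
      by (auto simp: ae_eq_def)
    from ae have "AE x in M. f x = h x" by eventually_elim simp
    with * show "(f, h) \<in> ae_eq M" by (simp add: ae_eq_def)
  qed
qed

lemma mem_L2_class:
  "g \<in> L2_class M f \<longleftrightarrow> f \<in> square_integrable M \<and> g \<in> square_integrable M \<and> (AE x in M. f x = g x)"
  by (auto simp: L2_class_def ae_eq_def)

lemma L2_class_eqI:
  assumes "f \<in> square_integrable M" "g \<in> square_integrable M" "AE x in M. f x = g x"
  shows "L2_class M f = L2_class M g"
  unfolding L2_class_def using assms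
  by (intro equiv_class_eq[OF equiv_ae_eq]) (auto simp: ae_eq_def)

lemma L2_class_in_vecs:
  "f \<in> square_integrable M \<Longrightarrow> L2_class M f \<in> vecs (L2 M)"
  by (auto simp: L2_def L2_class_def quotient_def)

lemma vecs_L2_E:
  assumes "A \<in> vecs (L2 M)"
  obtains f where "f \<in> square_integrable M" "A = L2_class M f"
  using assms by (auto simp: L2_def L2_class_def quotient_def)

lemma UN_const:
  assumes "a \<in> A" "\<And>a. a \<in> A \<Longrightarrow> F a = C"
  shows "(\<Union>a\<in>A. F a) = C"
proof -
  have "(\<Union>a\<in>A. F a) = (\<Union>a\<in>A. C)" using assms(2) by simp
  then show ?thesis using assms(1) by auto
qed

lemma UN_const2:
  assumes "a \<in> A" "b \<in> B" "\<And>a b. a \<in> A \<Longrightarrow> b \<in> B \<Longrightarrow> F a b = C"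
  shows "(\<Union>a\<in>A. \<Union>b\<in>B. F a b) = C"
  by (rule UN_const[OF assms(1)], rule UN_const[OF assms(2)], rule assms(3))

lemma vzero_L2: "vzero (L2 M) = L2_class M (\<lambda>x. 0)"
  by (simp add: L2_def)

lemma vadd_L2_class:
  assumes "f \<in> square_integrable M" "g \<in> square_integrable M"
  shows "vadd (L2 M) (L2_class M f) (L2_class M g) = L2_class M (\<lambda>x. f x + g x)"
proof -
  have "L2_class M (\<lambda>x. f' x + g' x) = L2_class M (\<lambda>x. f x + g x)"
    if "f' \<in> L2_class M f" "g' \<in> L2_class M g" for f' g'
  proof (intro L2_class_eqI square_integrable_add assms)
    have "AE x in M. f x = f' x" "AE x in M. g x = g' x"
      using that by (auto simp: mem_L2_class)
    then show "AE x in M. f' x + g' x = f x + g x" by eventually_elim simp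
  qed (use that in \<open>auto simp: mem_L2_class\<close>)
  moreover have "f \<in> L2_class M f" "g \<in> L2_class M g"
    using assms by (auto simp: mem_L2_class)
  ultimately show ?thesis unfolding L2_def inner_space.simps by - (rule UN_const2[of f _ g])
qed

lemma vscale_L2_class:
  assumes "f \<in> square_integrable M"
  shows "vscale (L2 M) c (L2_class M f) = L2_class M (\<lambda>x. c * f x)"
proof -
  have "L2_class M (\<lambda>x. c * f' x) = L2_class M (\<lambda>x. c * f x)" if "f' \<in> L2_class M f" for f'
  proof (intro L2_class_eqI square_integrable_scale assms)
    have "AE x in M. f x = f' x"
      using that by (auto simp: mem_L2_class)
    then show "AE x in M. c * f' x = c * f x" by eventually_elim simp
  qed (use that in \<open>auto simp: mem_L2_class\<close>)
  moreover have "f \<in> L2_class M f"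
    using assms by (auto simp: mem_L2_class)
  ultimately show ?thesis unfolding L2_def inner_space.simps by - (rule UN_const[of f])
qed

lemma vinner_L2_class:
  assumes "f \<in> square_integrable M" "g \<in> square_integrable M"
  shows "vinner (L2 M) (L2_class M f) (L2_class M g) = (\<integral>x. f x * cnj (g x) \<partial>M)"
proof -
  have "(\<integral>x. f' x * cnj (g' x) \<partial>M) = (\<integral>x. f x * cnj (g x) \<partial>M)"
    if "f' \<in> L2_class M f" "g' \<in> L2_class M g" for f' g'
  proof (rule integral_cong_AE)
    have [measurable]: "f \<in> borel_measurable M" "g \<in> borel_measurable M"
        "f' \<in> borel_measurable M" "g' \<in> borel_measurable M"
      using that by (auto simp: mem_L2_class square_integrable_def)
    have "cnj \<in> borel_measurable borel"
      by (intro borel_measurable_continuous_onI continuous_intros)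
    note [measurable] = this
    show "(\<lambda>x. f' x * cnj (g' x)) \<in> borel_measurable M"
         "(\<lambda>x. f x * cnj (g x)) \<in> borel_measurable M"
      by measurable
    have "AE x in M. f x = f' x" "AE x in M. g x = g' x"
      using that by (auto simp: mem_L2_class)
    then show "AE x in M. f' x * cnj (g' x) = f x * cnj (g x)" by eventually_elim simp
  qed
  moreover have "f \<in> L2_class M f" "g \<in> L2_class M g"
    using assms by (auto simp: mem_L2_class)
  ultimately have "(\<Union>f'\<in>L2_class M f. \<Union>g'\<in>L2_class M g. {\<integral>x. f' x * cnj (g' x) \<partial>M})
      = {\<integral>x. f x * cnj (g x) \<partial>M}"
    by - (rule UN_const2[of f _ g], assumption, assumption, rule arg_cong[where f = "\<lambda>z. {z}"])
  then show ?thesis by (simp add: L2_def)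
qed


section \<open>Riesz bases of characters\<close>

text \<open>Only the values on \<open>\<Omega>\<close> matter in \<open>L2 (restrict_space \<mu> \<Omega>)\<close>, so the class of a character
  there is the class of its restriction to \<open>\<Omega>\<close>. The family is indexed by \<open>\<Lambda>\<close> itself.\<close>

definition forms_riesz_basis ::
    "'a::topological_ab_group_add measure \<Rightarrow> 'a set \<Rightarrow> ('a \<Rightarrow> complex) set \<Rightarrow> bool" where
  "forms_riesz_basis \<mu> \<Omega> \<Lambda> \<longleftrightarrow>
     riesz_basis (L2 (restrict_space \<mu> \<Omega>)) \<Lambda> (L2_class (restrict_space \<mu> \<Omega>))"

end

theory Submission
  imports Defs "HOL-Library.Function_Algebras"
begin

text \<open>Since \<open>\<Omega>\<close> is compact and open, it is a finite disjoint union of cosets \<open>k + H\<close>, \<open>k \<in> A\<close>, of one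
  open subgroup \<open>H\<close>, so \<open>L\<^sup>2(\<Omega>)\<close> is the orthogonal sum of the spaces \<open>L\<^sup>2(k + H)\<close>. Take
  countably many characters of the whole group whose span is dense in \<open>L\<^sup>2(\<Omega>)\<close>, and let \<open>X\<close>
  contain exactly one character from each class of those that agree on \<open>H\<close>. The functions \<open>1\<^bsub>k+H\<^esub> \<xi>\<close>, with
  \<open>\<xi> \<in> X\<close> and \<open>k \<in> A\<close>, form, up to a common factor, an orthonormal basis of \<open>L\<^sup>2(\<Omega>)\<close>. To replace them by
  characters of the whole group, choose characters \<open>\<psi> k\<close>, \<open>k \<in> A\<close>, that are trivial on \<open>H\<close>, hence
  constant on cosets, such that the matrix \<open>\<psi> k l\<close>, \<open>k, l \<in> A\<close>, is invertible; they exist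
  because characters separate the cosets of \<open>H\<close>. On \<open>\<Omega>\<close> the products \<open>\<xi> \<psi> k\<close>, for
  one \<open>\<xi>\<close>, arise from the functions \<open>1\<^bsub>l+H\<^esub> \<xi>\<close> by this matrix, and the matrix is the same for
  all \<open>\<xi>\<close>. Therefore \<open>\<Lambda> = {\<xi> \<psi> k | \<xi> \<in> X, k \<in> A}\<close> is a Riesz basis, with constants that depend
  only on one finite matrix and on the measure of \<open>H\<close>.

  Four facts carry the argument. The theorem \<open>riesz_basis_L2I\<close> turns norm equivalence on finite
  linear combinations into a bounded invertible operator; it rests on the completeness of \<open>L\<^sup>2\<close>.
  The lemma \<open>character_separates\<close> provides enough characters: a homomorphism from a subgroup to
  the circle extends to the whole group because the circle is divisible, and it is continuous
  if it is trivial on an open subgroup. The lemma \<open>coset_indicator_in_span\<close> derives that indicators of cosets are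
  combinations of characters; it is used for \<open>H\<close>, to find the \<open>\<psi> k\<close>, and for arbitrarily small
  open subgroups, to see that characters span a dense subspace. Finally \<open>complete_coset_indicators\<close> deduces
  from the regularity of Haar measure that the indicators of cosets are complete.\<close>

section \<open>Complex-valued functions as a vector space\<close>

interpretation fun_space: vector_space "\<lambda>(c::complex) (f::'a \<Rightarrow> complex) x. c * f x"
  by unfold_locales (auto simp: fun_eq_iff algebra_simps)

lemma sum_fun_apply: "(\<Sum>i\<in>F. f i) x = (\<Sum>i\<in>F. f i x)"
  by (induction F rule: infinite_finite_induct) auto

text \<open>Elements of \<open>L\<^sup>2(\<Omega>)\<close> are represented by functions on the whole group, of which only the values
  on \<open>\<Omega>\<close> matter. Hence linear combinations are compared on a set \<open>S\<close>.\<close>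

definition span_on :: "'a set \<Rightarrow> ('a \<Rightarrow> complex) set \<Rightarrow> ('a \<Rightarrow> complex) set" where
  "span_on S F = {g. \<exists>s\<in>fun_space.span F. \<forall>x\<in>S. g x = s x}"

lemma span_onI: "s \<in> fun_space.span F \<Longrightarrow> (\<And>x. x \<in> S \<Longrightarrow> g x = s x) \<Longrightarrow> g \<in> span_on S F"
  by (auto simp: span_on_def)

lemma span_on_base: "g \<in> F \<Longrightarrow> g \<in> span_on S F"
  by (rule span_onI[OF fun_space.span_base]) auto

lemma span_on_zero: "0 \<in> span_on S F"
  by (rule span_onI[OF fun_space.span_zero]) auto

lemma span_on_add:
  assumes "g \<in> span_on S F" "h \<in> span_on S F" shows "g + h \<in> span_on S F"
proof -
  from assms obtain s t where st: "s \<in> fun_space.span F" "t \<in> fun_space.span F"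
    "\<forall>x\<in>S. g x = s x" "\<forall>x\<in>S. h x = t x" by (auto simp: span_on_def)
  show ?thesis by (rule span_onI[OF fun_space.span_add[OF st(1,2)]]) (use st in simp)
qed

lemma span_on_scale:
  assumes "g \<in> span_on S F" shows "(\<lambda>x. c * g x) \<in> span_on S F"
proof -
  from assms obtain s where s: "s \<in> fun_space.span F" "\<forall>x\<in>S. g x = s x"
    by (auto simp: span_on_def)
  show ?thesis by (rule span_onI[OF fun_space.span_scale[OF s(1), of c]]) (use s in simp)
qed

lemma span_on_sum: "(\<And>i. i \<in> A \<Longrightarrow> g i \<in> span_on S F) \<Longrightarrow> (\<Sum>i\<in>A. g i) \<in> span_on S F"
  by (induction A rule: infinite_finite_induct) (auto simp: span_on_zero intro: span_on_add)

lemma span_on_cong: "g \<in> span_on S F \<Longrightarrow> (\<And>x. x \<in> S \<Longrightarrow> h x = g x) \<Longrightarrow> h \<in> span_on S F"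
  by (auto simp: span_on_def)

lemma span_subset_span_on:
  assumes "E \<subseteq> span_on S F" shows "fun_space.span E \<subseteq> span_on S F"
proof
  fix g assume "g \<in> fun_space.span E"
  then show "g \<in> span_on S F"
  proof (induction rule: fun_space.span_induct_alt)
    case (step c f y)
    then show ?case using assms by (blast intro: span_on_add span_on_scale)
  qed (rule span_on_zero)
qed

lemma span_on_trans:
  assumes "E \<subseteq> span_on S F" shows "span_on S E \<subseteq> span_on S F"
  using span_subset_span_on[OF assms] by (auto simp: span_on_def[of S E] intro: span_on_cong)

lemma span_on_mono: "E \<subseteq> F \<Longrightarrow> span_on S E \<subseteq> span_on S F"
  by (rule span_on_trans) (auto intro: span_on_base)

text \<open>To multiply a linear combination by a fixed function it suffices to multiply the generators.
  Below, the fixed function is a factor of a product of characters or the indicator of a coset.\<close>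

lemma span_on_mult:
  assumes "g \<in> span_on S F" "\<And>f. f \<in> F \<Longrightarrow> (\<lambda>x. u x * f x) \<in> span_on S E"
  shows "(\<lambda>x. u x * g x) \<in> span_on S E"
proof -
  from assms(1) obtain s where s: "s \<in> fun_space.span F" "\<forall>x\<in>S. g x = s x"
    by (auto simp: span_on_def)
  have "(\<lambda>x. u x * s x) \<in> span_on S E" using s(1)
  proof (induction rule: fun_space.span_induct_alt)
    case base
    show ?case using span_on_zero[of S E] by (simp add: zero_fun_def)
  next
    case (step c f y)
    have "(\<lambda>x. c * (u x * f x)) + (\<lambda>x. u x * y x) \<in> span_on S E"
      by (intro span_on_add span_on_scale step assms(2))
    then show ?case by (rule span_on_cong) (auto simp: algebra_simps)
  qed
  then show ?thesis by (rule span_on_cong) (use s in auto)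
qed

lemma span_on_finite_support:
  assumes "g \<in> span_on S F" obtains t where "finite t" "t \<subseteq> F" "g \<in> span_on S t"
proof -
  from assms obtain s where s: "s \<in> fun_space.span F" "\<forall>x\<in>S. g x = s x"
    by (auto simp: span_on_def)
  from s(1) obtain t r where t: "finite t" "t \<subseteq> F" "s = (\<Sum>a\<in>t. (\<lambda>x. r a * a x))"
    unfolding fun_space.span_explicit by auto
  have "s \<in> fun_space.span t" unfolding t(3)
    by (intro fun_space.span_sum fun_space.span_scale fun_space.span_base)
  then have "g \<in> span_on S t" by (rule span_onI) (use s in simp)
  then show ?thesis using t(1,2) that by blast
qed

section \<open>Square integrable functions\<close>

definition sqnorm :: "'a measure \<Rightarrow> ('a \<Rightarrow> complex) \<Rightarrow> real" where
  "sqnorm M f = (\<integral>x. (cmod (f x))\<^sup>2 \<partial>M)"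

lemma sqnorm_nonneg [simp]: "0 \<le> sqnorm M f"
  by (simp add: sqnorm_def)

lemma sqnorm_cong: "(\<And>x. x \<in> space M \<Longrightarrow> f x = g x) \<Longrightarrow> sqnorm M f = sqnorm M g"
  unfolding sqnorm_def by (rule Bochner_Integration.integral_cong) auto

lemma sqint_add: "f \<in> square_integrable M \<Longrightarrow> g \<in> square_integrable M \<Longrightarrow> f + g \<in> square_integrable M"
  using square_integrable_add[of f M g] by (simp add: plus_fun_def)

lemma sqint_zero: "0 \<in> square_integrable M"
  by (simp add: square_integrable_def zero_fun_def)

lemma sqint_diff:
  assumes "f \<in> square_integrable M" "g \<in> square_integrable M" 
  shows "f - g \<in> square_integrable M"
proof -
  have "f + (\<lambda>x. (-1) * g x) = f - g" by (auto simp: fun_eq_iff)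
  with sqint_add[OF assms(1) square_integrable_scale[OF assms(2), of "-1"]] show ?thesis by simp
qed

lemma sqint_span:
  assumes "E \<subseteq> square_integrable M" "s \<in> fun_space.span E" shows "s \<in> square_integrable M"
  using assms(2)
proof (induction rule: fun_space.span_induct_alt)
  case (step c f y)
  then show ?case using assms(1) by (blast intro: sqint_add square_integrable_scale)
qed (rule sqint_zero)

lemma sqint_integrable: "f \<in> square_integrable M \<Longrightarrow> integrable M (\<lambda>x. (cmod (f x))\<^sup>2)"
  by (simp add: square_integrable_def)

lemma sqint_measurable: "f \<in> square_integrable M \<Longrightarrow> f \<in> borel_measurable M"
  by (simp add: square_integrable_def)

lemma sqnorm_scale: "sqnorm M (\<lambda>x. c * f x) = (cmod c)\<^sup>2 * sqnorm M f"
  by (simp add: sqnorm_def norm_mult power_mult_distrib)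

lemma sqnorm_scale_small:
  assumes "0 < \<epsilon>"
  shows "\<exists>\<delta>>0. \<forall>p q. sqnorm M (p - q) < \<delta> \<longrightarrow> sqnorm M ((\<lambda>x. c * p x) - (\<lambda>x. c * q x)) < \<epsilon>"
proof -
  define \<delta> where "\<delta> = \<epsilon> / ((cmod c)\<^sup>2 + 1)"
  have pos: "0 < (cmod c)\<^sup>2 + 1" by (simp add: add_nonneg_pos)
  have "sqnorm M ((\<lambda>x. c * p x) - (\<lambda>x. c * q x)) < \<epsilon>" if "sqnorm M (p - q) < \<delta>" for p q
  proof -
    have "(\<lambda>x. c * p x) - (\<lambda>x. c * q x) = (\<lambda>x. c * (p - q) x)" by (auto simp: fun_eq_iff algebra_simps)
    then have "sqnorm M ((\<lambda>x. c * p x) - (\<lambda>x. c * q x)) = (cmod c)\<^sup>2 * sqnorm M (p - q)"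
      by (simp only: sqnorm_scale)
    also have "\<dots> \<le> ((cmod c)\<^sup>2 + 1) * sqnorm M (p - q)" by (simp add: algebra_simps)
    also have "\<dots> < ((cmod c)\<^sup>2 + 1) * \<delta>" using that pos by (rule mult_strict_left_mono)
    also have "\<dots> = \<epsilon>" using pos by (simp add: \<delta>_def)
    finally show ?thesis .
  qed
  moreover have "0 < \<delta>" using assms pos by (simp add: \<delta>_def)
  ultimately show ?thesis by blast
qed

lemma sqnorm_zero [simp]: "sqnorm M 0 = 0"
  by (simp add: sqnorm_def)

lemma sqnorm_minus_commute: "sqnorm M (f - g) = sqnorm M (g - f)"
  by (simp add: sqnorm_def norm_minus_commute)

text \<open>This crude substitute for the triangle inequality suffices throughout, because only the
  topology defined by the seminorm matters and the constants in a Riesz basis are arbitrary.\<close>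

lemma sqnorm_add_le:
  assumes "f \<in> square_integrable M" "g \<in> square_integrable M"
  shows "sqnorm M (f + g) \<le> 2 * sqnorm M f + 2 * sqnorm M g"
proof -
  have le: "(cmod (a + b))\<^sup>2 \<le> 2 * (cmod a)\<^sup>2 + 2 * (cmod b)\<^sup>2" for a b :: complex
  proof -
    have "(cmod (a + b))\<^sup>2 \<le> (cmod a + cmod b)\<^sup>2"
      by (intro power_mono norm_triangle_ineq norm_ge_zero)
    also have "\<dots> \<le> 2 * (cmod a)\<^sup>2 + 2 * (cmod b)\<^sup>2"
      using zero_le_power2[of "cmod a - cmod b"] by (simp add: power2_eq_square algebra_simps)
    finally show ?thesis .
  qed
  have "sqnorm M (f + g) \<le> (\<integral>x. 2 * (cmod (f x))\<^sup>2 + 2 * (cmod (g x))\<^sup>2 \<partial>M)"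
    unfolding sqnorm_def
    by (rule integral_mono) (use sqint_integrable[OF sqint_add[OF assms]] sqint_integrable[OF assms(1)]
        sqint_integrable[OF assms(2)] le in auto)
  also have "\<dots> = 2 * sqnorm M f + 2 * sqnorm M g"
    using sqint_integrable[OF assms(1)] sqint_integrable[OF assms(2)] by (simp add: sqnorm_def)
  finally show ?thesis .
qed

lemma sqnorm_diff_le:
  assumes "f \<in> square_integrable M" "g \<in> square_integrable M" "h \<in> square_integrable M"
  shows "sqnorm M (f - h) \<le> 2 * sqnorm M (f - g) + 2 * sqnorm M (g - h)"
  using sqnorm_add_le[OF sqint_diff[OF assms(1,2)] sqint_diff[OF assms(2,3)]] by simp

lemma sqnorm_diff0_le:
  assumes "f \<in> square_integrable M" "g \<in> square_integrable M"
  shows "sqnorm M f \<le> 2 * sqnorm M (f - g) + 2 * sqnorm M g"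
  using sqnorm_add_le[OF sqint_diff[OF assms(1,2)] assms(2)] by simp

lemma sqnorm_eq_0_iff:
  assumes "f \<in> square_integrable M"
  shows "sqnorm M f = 0 \<longleftrightarrow> (AE x in M. f x = 0)"
  unfolding sqnorm_def using integral_nonneg_eq_0_iff_AE[OF sqint_integrable[OF assms]] by simp

lemma vnorm_L2_class:
  assumes "f \<in> square_integrable M"
  shows "vnorm (L2 M) (L2_class M f) = sqrt (sqnorm M f)"
proof -
  have "vinner (L2 M) (L2_class M f) (L2_class M f) = (\<integral>x. complex_of_real ((cmod (f x))\<^sup>2) \<partial>M)"
    unfolding vinner_L2_class[OF assms assms]
    by (rule Bochner_Integration.integral_cong) (simp_all only: complex_norm_square)
  also have "\<dots> = complex_of_real (sqnorm M f)"
    unfolding sqnorm_def by (rule integral_complex_of_real)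
  finally show ?thesis by (simp add: vnorm_def)
qed

lemma vdist_L2_class:
  assumes "f \<in> square_integrable M" "g \<in> square_integrable M"
  shows "vdist (L2 M) (L2_class M f) (L2_class M g) = sqrt (sqnorm M (f - g))"
proof -
  have "(\<lambda>x. f x + - 1 * g x) = f - g" by (auto simp: fun_eq_iff)
  then show ?thesis
    using assms square_integrable_scale[OF assms(2), of "-1"]
    by (simp add: vdist_def vscale_L2_class vadd_L2_class vnorm_L2_class sqint_diff
        del: mult_minus1 mult_minus_left)
qed

text \<open>Completeness of \<open>L\<^sup>2\<close>, for sequences that converge fast enough. The weights \<open>4 ^ k\<close> are chosen so that
  \<open>\<Sum>k. 4 ^ k * \<bar>v (k+1) - v k\<bar>\<^sup>2\<close> is still integrable, hence finite almost everywhere, while a bound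
  on it forces the increments to decay like \<open>2 ^ -k\<close> pointwise.\<close>

lemma sqint_complete_fast:
  assumes v: "\<And>n. v n \<in> square_integrable M"
    and fast: "\<And>n. sqnorm M (v (Suc n) - v n) \<le> C * (1/8) ^ n"
  shows "\<exists>h\<in>square_integrable M. (\<lambda>n. sqnorm M (v n - h)) \<longlonglongrightarrow> 0"
proof -
  note [measurable] = sqint_measurable[OF v]
  define d where "d n = v (Suc n) - v n" for n
  have d: "d n \<in> square_integrable M" for n unfolding d_def by (intro sqint_diff v)
  note [measurable] = sqint_measurable[OF d]
  define w where "w n x = 4 ^ n * (cmod (d n x))\<^sup>2" for n x
  define s where "s x = (\<Sum>n. w n x)" for x
  have w_nn: "0 \<le> w n x" for n x by (simp add: w_def)
  have w_int: "integrable M (w n)" for n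
    unfolding w_def using sqint_integrable[OF d] by simp
  have w_le: "(\<integral>x. w n x \<partial>M) \<le> C * (1/2) ^ n" for n
  proof -
    have "(\<integral>x. w n x \<partial>M) = 4 ^ n * sqnorm M (d n)" by (simp add: w_def sqnorm_def)
    also have "\<dots> \<le> 4 ^ n * (C * (1/8) ^ n)"
      using fast[of n] by (intro mult_left_mono) (auto simp: d_def)
    also have "\<dots> = C * (4 * (1/8)) ^ n" unfolding power_mult_distrib by (rule mult.left_commute)
    also have "\<dots> = C * (1/2) ^ n" by simp
    finally show ?thesis .
  qed
  have sum_int: "summable (\<lambda>n. \<integral>x. norm (w n x) \<partial>M)"
  proof (rule summable_comparison_test')
    show "summable (\<lambda>n. C * (1/2) ^ n)" by (intro summable_mult summable_geometric) simp
    show "norm (\<integral>x. norm (w n x) \<partial>M) \<le> C * (1/2) ^ n" if "0 \<le> n" for n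
      using w_le[of n] w_nn by (simp add: integral_nonneg_AE)
  qed
  have ae: "AE x in M. summable (\<lambda>n. norm (w n x))"
  proof -
    have "(\<integral>\<^sup>+x. (\<Sum>n. ennreal (w n x)) \<partial>M) = (\<Sum>n. \<integral>\<^sup>+x. ennreal (w n x) \<partial>M)"
      by (rule nn_integral_suminf) (auto simp: w_def)
    also have "\<dots> = (\<Sum>n. ennreal (\<integral>x. w n x \<partial>M))"
      using w_int w_nn by (simp add: nn_integral_eq_integral)
    also have "\<dots> = ennreal (\<Sum>n. \<integral>x. w n x \<partial>M)"
      using sum_int w_nn by (intro suminf_ennreal2) (auto simp: integral_nonneg_AE)
    finally have "(\<integral>\<^sup>+x. (\<Sum>n. ennreal (w n x)) \<partial>M) \<noteq> \<infinity>" by simp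
    then have "AE x in M. (\<Sum>n. ennreal (w n x)) \<noteq> \<infinity>"
      by (intro nn_integral_noteq_infinite) (auto simp: w_def)
    then show ?thesis
      by eventually_elim (use w_nn in \<open>auto intro!: summable_suminf_not_top\<close>)
  qed
  have s_int: "integrable M s"
    unfolding s_def by (rule integrable_suminf[OF w_int ae sum_int])
  have s_nn: "0 \<le> s x" if "summable (\<lambda>n. norm (w n x))" for x
    using that w_nn unfolding s_def by (intro suminf_nonneg) auto
  define h where "h x = lim (\<lambda>n. v n x)" for x
  have h_meas [measurable]: "h \<in> borel_measurable M" unfolding h_def by measurable
  have bound: "(cmod (v n x - h x))\<^sup>2 \<le> 4 * (1/4) ^ n * s x"
    if sx: "summable (\<lambda>n. norm (w n x))" for n x
  proof -
    have sx': "summable (\<lambda>n. w n x)" using sx w_nn by simp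
    have dk: "cmod (d k x) \<le> sqrt (s x) * (1/2) ^ k" for k
    proof -
      have "w k x \<le> s x" unfolding s_def
        using sum_le_suminf[OF sx', of "{k}"] w_nn by auto
      then have "sqrt (w k x) \<le> sqrt (s x)" by simp
      moreover have "sqrt (w k x) = 2 ^ k * cmod (d k x)"
        using real_sqrt_power[of 4 k] by (simp add: w_def real_sqrt_mult)
      ultimately show ?thesis by (simp add: field_simps)
    qed
    have sd: "summable (\<lambda>k. d k x)"
      by (rule summable_comparison_test'[of "\<lambda>k. sqrt (s x) * (1/2) ^ k"])
         (use dk in \<open>auto intro!: summable_mult summable_geometric\<close>)
    have "(\<lambda>m. \<Sum>k<m. d k x) \<longlonglongrightarrow> (\<Sum>k. d k x)" using sd by (rule summable_LIMSEQ)
    moreover have "(\<Sum>k<m. d k x) = v m x - v 0 x" for m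
      by (induction m) (auto simp: d_def)
    ultimately have "(\<lambda>m. (v m x - v 0 x) + v 0 x) \<longlonglongrightarrow> (\<Sum>k. d k x) + v 0 x"
      by (intro tendsto_intros) simp
    then have "convergent (\<lambda>m. v m x)" by (auto simp: convergent_def)
    then have lim: "(\<lambda>m. v m x) \<longlonglongrightarrow> h x" unfolding h_def by (simp add: convergent_LIMSEQ_iff)
    have "cmod (v (n + m) x - v n x) \<le> 2 * sqrt (s x) * (1/2) ^ n" for m
    proof -
      have "cmod (v (n + m) x - v n x) \<le> sqrt (s x) * (1/2) ^ n * (2 - 2 * (1/2) ^ m)"
      proof (induction m)
        case (Suc m)
        have "v (n + Suc m) x - v n x = (v (n + m) x - v n x) + d (n + m) x" by (simp add: d_def)
        also have "cmod \<dots> \<le> sqrt (s x) * (1/2) ^ n * (2 - 2 * (1/2) ^ m) + sqrt (s x) * (1/2) ^ (n + m)"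
          by (rule order_trans[OF norm_triangle_ineq add_mono[OF Suc dk]])
        also have "\<dots> = sqrt (s x) * (1/2) ^ n * (2 - 2 * (1/2) ^ Suc m)"
          by (simp add: power_add algebra_simps)
        finally show ?case .
      qed simp
      also have "\<dots> \<le> sqrt (s x) * (1/2) ^ n * 2"
        using s_nn[OF sx] by (intro mult_left_mono) auto
      finally show ?thesis by simp
    qed
    moreover have "(\<lambda>m. cmod (v (n + m) x - v n x)) \<longlonglongrightarrow> cmod (h x - v n x)"
      using LIMSEQ_ignore_initial_segment[OF lim, of n]
      by (intro tendsto_intros) (simp add: add.commute)
    ultimately have "cmod (h x - v n x) \<le> 2 * sqrt (s x) * (1/2) ^ n"
      by (intro LIMSEQ_le_const2) auto
    then have "(cmod (v n x - h x))\<^sup>2 \<le> (2 * sqrt (s x) * (1/2) ^ n)\<^sup>2"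
      by (intro power_mono) (auto simp: norm_minus_commute)
    also have "\<dots> = 4 * ((1/2) ^ n)\<^sup>2 * s x" using s_nn[OF sx] by (simp add: power_mult_distrib)
    also have "((1/2::real) ^ n)\<^sup>2 = (1/4) ^ n"
      by (subst power_mult[symmetric], subst mult.commute, subst power_mult) (simp add: power2_eq_square)
    finally show ?thesis .
  qed
  have vh: "v n - h \<in> square_integrable M" for n
  proof -
    have [measurable]: "v n - h \<in> borel_measurable M" unfolding fun_diff_def by measurable
    have "integrable M (\<lambda>x. (cmod ((v n - h) x))\<^sup>2)"
    proof (rule Bochner_Integration.integrable_bound)
      show "integrable M (\<lambda>x. 4 * (1/4) ^ n * s x)" using s_int by simp
      show "AE x in M. norm ((cmod ((v n - h) x))\<^sup>2) \<le> norm (4 * (1/4) ^ n * s x)"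
        using ae by eventually_elim (use bound s_nn in auto)
    qed measurable
    then show ?thesis unfolding square_integrable_def by simp
  qed
  have h: "h \<in> square_integrable M"
    using sqint_diff[OF v vh, of 0 0] by simp
  have "(\<lambda>n. sqnorm M (v n - h)) \<longlonglongrightarrow> 0"
  proof (rule tendsto_sandwich[where f="\<lambda>_. 0" and h = "\<lambda>n. 4 * (1/4) ^ n * (\<integral>x. s x \<partial>M)"])
    show "\<forall>\<^sub>F n in sequentially. sqnorm M (v n - h) \<le> 4 * (1/4) ^ n * (\<integral>x. s x \<partial>M)"
    proof (rule always_eventually, rule allI)
      fix n
      have "sqnorm M (v n - h) \<le> (\<integral>x. 4 * (1/4) ^ n * s x \<partial>M)" unfolding sqnorm_def
      proof (rule integral_mono_AE[OF sqint_integrable[OF vh]])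
        show "AE x in M. (cmod ((v n - h) x))\<^sup>2 \<le> 4 * (1/4) ^ n * s x"
          using ae by eventually_elim (use bound in auto)
      qed (use s_int in simp)
      then show "sqnorm M (v n - h) \<le> 4 * (1/4) ^ n * (\<integral>x. s x \<partial>M)" by simp
    qed
    have "(\<lambda>n. (1/4::real) ^ n) \<longlonglongrightarrow> 0" by (rule LIMSEQ_power_zero) simp
    from tendsto_mult[OF tendsto_mult[OF tendsto_const this, of 4] tendsto_const]
    show "(\<lambda>n. 4 * (1/4) ^ n * (\<integral>x. s x \<partial>M)) \<longlonglongrightarrow> 0" by simp
  qed auto
  with h show ?thesis by blast
qed

section \<open>Closing the graph of a densely defined bounded operator\<close>

text \<open>A bounded operator given on a dense subspace is extended by taking the closure of its graph
  \<open>P\<close>. Working with pairs of functions has two advantages: no choice of coefficients enters, and the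
  inverse operator is obtained from the same construction for \<open>P\<inverse>\<close>.\<close>

definition graph_closure :: "'a measure \<Rightarrow> (('a \<Rightarrow> complex) \<times> ('a \<Rightarrow> complex)) set \<Rightarrow> (('a \<Rightarrow> complex) \<times> ('a \<Rightarrow> complex)) set" where
  "graph_closure M P = {(g, h). g \<in> square_integrable M \<and> h \<in> square_integrable M \<and>
     (\<forall>\<epsilon>>0. \<exists>(u, v)\<in>P. sqnorm M (g - u) < \<epsilon> \<and> sqnorm M (h - v) < \<epsilon>)}"

lemma graph_closureD:
  assumes "(g, h) \<in> graph_closure M P"
  shows "g \<in> square_integrable M" "h \<in> square_integrable M"
    and "0 < \<epsilon> \<Longrightarrow> \<exists>u v. (u, v) \<in> P \<and> sqnorm M (g - u) < \<epsilon> \<and> sqnorm M (h - v) < \<epsilon>"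
  using assms by (force simp: graph_closure_def)+

lemma graph_closureI:
  assumes "g \<in> square_integrable M" "h \<in> square_integrable M"
    and "\<And>\<epsilon>. 0 < \<epsilon> \<Longrightarrow> \<exists>u v. (u, v) \<in> P \<and> sqnorm M (g - u) < \<epsilon> \<and> sqnorm M (h - v) < \<epsilon>"
  shows "(g, h) \<in> graph_closure M P"
  using assms by (force simp: graph_closure_def)

lemma graph_closure_converse:
  "(g, h) \<in> graph_closure M (P\<inverse>) \<longleftrightarrow> (h, g) \<in> graph_closure M P"
  by (auto intro!: graph_closureI dest: graph_closureD; blast dest: graph_closureD)

locale bounded_graph =
  fixes M :: "'a measure" and P :: "(('a \<Rightarrow> complex) \<times> ('a \<Rightarrow> complex)) set" and K :: real
  assumes subset: "P \<subseteq> square_integrable M \<times> square_integrable M"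
    and add: "(u, v) \<in> P \<Longrightarrow> (u', v') \<in> P \<Longrightarrow> (u + u', v + v') \<in> P"
    and scale: "(u, v) \<in> P \<Longrightarrow> ((\<lambda>x. c * u x), (\<lambda>x. c * v x)) \<in> P"
    and bound: "(u, v) \<in> P \<Longrightarrow> sqnorm M v \<le> K * sqnorm M u"
    and dense: "g \<in> square_integrable M \<Longrightarrow> 0 < \<epsilon> \<Longrightarrow> \<exists>u v. (u, v) \<in> P \<and> sqnorm M (g - u) < \<epsilon>"
    and K_nonneg: "0 \<le> K"
begin

abbreviation "G \<equiv> graph_closure M P"

lemma P_sqint: "(u, v) \<in> P \<Longrightarrow> u \<in> square_integrable M" "(u, v) \<in> P \<Longrightarrow> v \<in> square_integrable M"
  using subset by auto

lemma P_diff: "(u, v) \<in> P \<Longrightarrow> (u', v') \<in> P \<Longrightarrow> (u - u', v - v') \<in> P"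
proof -
  assume *: "(u, v) \<in> P" "(u', v') \<in> P"
  have "u + (\<lambda>x. -1 * u' x) = u - u'" "v + (\<lambda>x. -1 * v' x) = v - v'" by (auto simp: fun_eq_iff)
  then show ?thesis using add[OF *(1) scale[OF *(2), of "-1"]] by simp
qed

lemma closure_subset: "(u, v) \<in> P \<Longrightarrow> (u, v) \<in> G"
proof (rule graph_closureI)
  fix \<epsilon> :: real assume "(u, v) \<in> P" "0 < \<epsilon>"
  moreover from this have "sqnorm M (u - u) < \<epsilon>" "sqnorm M (v - v) < \<epsilon>" by simp_all
  ultimately show "\<exists>u' v'. (u', v') \<in> P \<and> sqnorm M (u - u') < \<epsilon> \<and> sqnorm M (v - v') < \<epsilon>" by blast
qed (use P_sqint in blast)+

lemma closure_add:
  assumes "(g, h) \<in> G" "(g', h') \<in> G" shows "(g + g', h + h') \<in> G"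
proof (rule graph_closureI)
  note S = graph_closureD(1,2)[OF assms(1)] graph_closureD(1,2)[OF assms(2)]
  show "g + g' \<in> square_integrable M" "h + h' \<in> square_integrable M"
    using S by (auto intro: sqint_add)
  fix \<epsilon> :: real assume "0 < \<epsilon>"
  then have \<epsilon>: "0 < \<epsilon> / 4" by simp
  obtain u v where 1: "(u, v) \<in> P" "sqnorm M (g - u) < \<epsilon> / 4" "sqnorm M (h - v) < \<epsilon> / 4"
    using graph_closureD(3)[OF assms(1) \<epsilon>] by blast
  obtain u' v' where 2: "(u', v') \<in> P" "sqnorm M (g' - u') < \<epsilon> / 4" "sqnorm M (h' - v') < \<epsilon> / 4"
    using graph_closureD(3)[OF assms(2) \<epsilon>] by blast
  have "sqnorm M ((g + g') - (u + u')) < \<epsilon>"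
    using sqnorm_add_le[OF sqint_diff[OF S(1) P_sqint(1)[OF 1(1)]] sqint_diff[OF S(3) P_sqint(1)[OF 2(1)]]]
      1(2) 2(2) by (simp add: algebra_simps)
  moreover have "sqnorm M ((h + h') - (v + v')) < \<epsilon>"
    using sqnorm_add_le[OF sqint_diff[OF S(2) P_sqint(2)[OF 1(1)]] sqint_diff[OF S(4) P_sqint(2)[OF 2(1)]]]
      1(3) 2(3) by (simp add: algebra_simps)
  ultimately show "\<exists>u v. (u, v) \<in> P \<and> sqnorm M (g + g' - u) < \<epsilon> \<and> sqnorm M (h + h' - v) < \<epsilon>"
    using add[OF 1(1) 2(1)] by blast
qed

lemma closure_scale:
  assumes "(g, h) \<in> G" shows "((\<lambda>x. c * g x), (\<lambda>x. c * h x)) \<in> G"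
proof (rule graph_closureI)
  note S = graph_closureD(1,2)[OF assms]
  show "(\<lambda>x. c * g x) \<in> square_integrable M" "(\<lambda>x. c * h x) \<in> square_integrable M"
    using S by (auto intro: square_integrable_scale)
  fix \<epsilon> :: real assume "0 < \<epsilon>"
  then obtain \<delta> where \<delta>: "0 < \<delta>"
    and small: "\<And>p q. sqnorm M (p - q) < \<delta> \<Longrightarrow> sqnorm M ((\<lambda>x. c * p x) - (\<lambda>x. c * q x)) < \<epsilon>"
    using sqnorm_scale_small[of \<epsilon> M c] by blast
  obtain u v where 1: "(u, v) \<in> P" "sqnorm M (g - u) < \<delta>" "sqnorm M (h - v) < \<delta>"
    using graph_closureD(3)[OF assms \<delta>] by blast
  show "\<exists>u v. (u, v) \<in> P \<and> sqnorm M ((\<lambda>x. c * g x) - u) < \<epsilon> \<and> sqnorm M ((\<lambda>x. c * h x) - v) < \<epsilon>"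
    using small[OF 1(2)] small[OF 1(3)] scale[OF 1(1), of c] by blast
qed

text \<open>The factor 4 is the price of the crude triangle inequality. In particular, a pair in the
  closure with vanishing first component has vanishing second component, so the closure is again
  the graph of an operator on classes.\<close>

lemma closure_bound:
  assumes "(g, h) \<in> G" shows "sqnorm M h \<le> 4 * K * sqnorm M g"
proof (rule field_le_epsilon)
  note S = graph_closureD(1,2)[OF assms]
  fix \<epsilon> :: real assume "0 < \<epsilon>"
  define \<delta> where "\<delta> = \<epsilon> / (2 + 4 * K)"
  have \<delta>: "0 < \<delta>" using \<open>0 < \<epsilon>\<close> K_nonneg by (simp add: \<delta>_def add_pos_nonneg)
  obtain u v where 1: "(u, v) \<in> P" "sqnorm M (g - u) < \<delta>" "sqnorm M (h - v) < \<delta>"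
    using graph_closureD(3)[OF assms \<delta>] by blast
  have "sqnorm M u \<le> 2 * \<delta> + 2 * sqnorm M g"
    using sqnorm_diff0_le[OF P_sqint(1)[OF 1(1)] S(1)] 1(2) by (simp add: sqnorm_minus_commute)
  then have "K * sqnorm M u \<le> K * (2 * \<delta> + 2 * sqnorm M g)" by (rule mult_left_mono) (rule K_nonneg)
  with bound[OF 1(1)] have "sqnorm M v \<le> 2 * K * \<delta> + 2 * K * sqnorm M g" by (simp add: algebra_simps)
  with sqnorm_diff0_le[OF S(2) P_sqint(2)[OF 1(1)]] 1(3)
  have "sqnorm M h \<le> 2 * \<delta> + 4 * K * \<delta> + 4 * K * sqnorm M g" by (simp add: algebra_simps)
  also have "2 * \<delta> + 4 * K * \<delta> = (2 + 4 * K) * \<delta>" by (simp add: algebra_simps)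
  also have "\<dots> = \<epsilon>" using K_nonneg by (simp add: \<delta>_def)
  finally show "sqnorm M h \<le> 4 * K * sqnorm M g + \<epsilon>" by simp
qed

text \<open>Approximants \<open>u n\<close> of \<open>g\<close> with errors \<open>8 ^ -n\<close> have images that form a fast Cauchy
  sequence; its limit is the value at \<open>g\<close>.\<close>

lemma closure_total:
  assumes g: "g \<in> square_integrable M" shows "\<exists>h. (g, h) \<in> G"
proof -
  have "\<exists>u v. (u, v) \<in> P \<and> sqnorm M (g - u) < (1/8) ^ n" for n :: nat
    using dense[OF g] by simp
  then obtain u v where uv: "\<And>n. (u n, v n) \<in> P" "\<And>n. sqnorm M (g - u n) < (1/8) ^ n"
    by metis
  have step: "sqnorm M (v (Suc n) - v n) \<le> 4 * K * (1/8) ^ n" for n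
  proof -
    have "sqnorm M (u (Suc n) - u n) \<le> 2 * sqnorm M (g - u (Suc n)) + 2 * sqnorm M (g - u n)"
      using sqnorm_diff_le[OF P_sqint(1)[OF uv(1)] g P_sqint(1)[OF uv(1)], of "Suc n" n]
      by (simp only: sqnorm_minus_commute[of M g "u (Suc n)"])
    also have "\<dots> \<le> 2 * (1/8) ^ Suc n + 2 * (1/8) ^ n"
      using uv(2)[of n] uv(2)[of "Suc n"] by simp
    also have "\<dots> \<le> 4 * (1/8) ^ n" by simp
    finally have "K * sqnorm M (u (Suc n) - u n) \<le> K * (4 * (1/8) ^ n)"
      by (rule mult_left_mono) (rule K_nonneg)
    with bound[OF P_diff[OF uv(1) uv(1)], of "Suc n" n] show ?thesis by simp
  qed
  obtain h where h: "h \<in> square_integrable M" "(\<lambda>n. sqnorm M (v n - h)) \<longlonglongrightarrow> 0"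
    using sqint_complete_fast[OF P_sqint(2)[OF uv(1)] step] by blast
  have "(g, h) \<in> G"
  proof (rule graph_closureI[OF g h(1)])
    fix \<epsilon> :: real assume "0 < \<epsilon>"
    have "(\<lambda>n. (1/8::real) ^ n) \<longlonglongrightarrow> 0" by (rule LIMSEQ_power_zero) simp
    then have "\<forall>\<^sub>F n in sequentially. (1/8::real) ^ n < \<epsilon>" using \<open>0 < \<epsilon>\<close> by (rule order_tendstoD)
    moreover have "\<forall>\<^sub>F n in sequentially. sqnorm M (v n - h) < \<epsilon>" using h(2) \<open>0 < \<epsilon>\<close> by (rule order_tendstoD)
    ultimately have "\<forall>\<^sub>F n in sequentially. (1/8::real) ^ n < \<epsilon> \<and> sqnorm M (v n - h) < \<epsilon>"
      by (rule eventually_conj)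
    then obtain n where n: "(1/8::real) ^ n < \<epsilon>" "sqnorm M (v n - h) < \<epsilon>"
      by (auto simp: eventually_sequentially)
    then have "sqnorm M (g - u n) < \<epsilon>" "sqnorm M (h - v n) < \<epsilon>"
      using uv(2)[of n] by (simp_all add: sqnorm_minus_commute[of M h])
    then show "\<exists>u v. (u, v) \<in> P \<and> sqnorm M (g - u) < \<epsilon> \<and> sqnorm M (h - v) < \<epsilon>"
      using uv(1)[of n] by blast
  qed
  then show ?thesis by blast
qed

definition closure_op :: "('a \<Rightarrow> complex) set \<Rightarrow> ('a \<Rightarrow> complex) set" where
  "closure_op A = L2_class M (SOME h. \<exists>g\<in>A. (g, h) \<in> G)"

lemma closure_op_eq:
  assumes gh: "(g, h) \<in> G" shows "closure_op (L2_class M g) = L2_class M h"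
proof -
  note S = graph_closureD(1,2)[OF gh]
  have "g \<in> L2_class M g" using S by (simp add: mem_L2_class)
  then have "\<exists>h. \<exists>g'\<in>L2_class M g. (g', h) \<in> G" using gh by blast
  from someI_ex[OF this] obtain g' where g': "g' \<in> L2_class M g"
    "(g', SOME h. \<exists>g\<in>L2_class M g. (g, h) \<in> G) \<in> G" (is "(_, ?h) \<in> _") by blast
  note S' = graph_closureD(1,2)[OF g'(2)]
  have d: "(g' - g, ?h - h) \<in> G"
  proof -
    have "g' + (\<lambda>x. -1 * g x) = g' - g" "?h + (\<lambda>x. -1 * h x) = ?h - h" by (auto simp: fun_eq_iff)
    then show ?thesis using closure_add[OF g'(2) closure_scale[OF gh, of "-1"]] by simp
  qed
  have "AE x in M. (g' - g) x = 0"
    using g'(1) by (auto simp: mem_L2_class elim: eventually_mono)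
  then have "sqnorm M (g' - g) = 0" using sqnorm_eq_0_iff[OF sqint_diff[OF S'(1) S(1)]] by simp
  with closure_bound[OF d] have "sqnorm M (?h - h) = 0" by (simp add: order_antisym)
  then have "AE x in M. (?h - h) x = 0" using sqnorm_eq_0_iff[OF sqint_diff[OF S'(2) S(2)]] by simp
  then show ?thesis unfolding closure_op_def
    by (intro L2_class_eqI S S') (auto elim: eventually_mono)
qed

lemma bounded_closure_op: "bounded_operator (L2 M) closure_op"
proof -
  have *: "\<exists>g h. x = L2_class M g \<and> (g, h) \<in> G" if "x \<in> vecs (L2 M)" for x
    using that closure_total by (metis vecs_L2_E)
  show ?thesis unfolding bounded_operator_def
  proof (intro conjI ballI allI exI[of _ "sqrt (4 * K)"])
    show "closure_op ` vecs (L2 M) \<subseteq> vecs (L2 M)"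
    proof (rule image_subsetI)
      fix x assume "x \<in> vecs (L2 M)"
      from *[OF this] obtain g h where gh: "x = L2_class M g" "(g, h) \<in> G" by blast
      show "closure_op x \<in> vecs (L2 M)"
        unfolding gh(1) closure_op_eq[OF gh(2)] by (rule L2_class_in_vecs[OF graph_closureD(2)[OF gh(2)]])
    qed
  next
    fix x y assume "x \<in> vecs (L2 M)" "y \<in> vecs (L2 M)"
    then obtain g h g' h' where gh: "x = L2_class M g" "(g, h) \<in> G" "y = L2_class M g'" "(g', h') \<in> G"
      using * by metis
    note S = graph_closureD(1,2)[OF gh(2)] graph_closureD(1,2)[OF gh(4)]
    have "vadd (L2 M) x y = L2_class M (g + g')"
      using S by (simp add: gh vadd_L2_class plus_fun_def)
    moreover have "vadd (L2 M) (closure_op x) (closure_op y) = L2_class M (h + h')"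
      using S by (simp add: gh(1,3) closure_op_eq[OF gh(2)] closure_op_eq[OF gh(4)] vadd_L2_class plus_fun_def)
    ultimately show "closure_op (vadd (L2 M) x y) = vadd (L2 M) (closure_op x) (closure_op y)"
      using closure_op_eq[OF closure_add[OF gh(2,4)]] by simp
  next
    fix c x assume "x \<in> vecs (L2 M)"
    then obtain g h where gh: "x = L2_class M g" "(g, h) \<in> G" using * by metis
    note S = graph_closureD(1,2)[OF gh(2)]
    show "closure_op (vscale (L2 M) c x) = vscale (L2 M) c (closure_op x)"
      using S by (simp add: gh(1) closure_op_eq[OF gh(2)] vscale_L2_class closure_op_eq[OF closure_scale[OF gh(2)]])
  next
    fix x assume "x \<in> vecs (L2 M)"
    then obtain g h where gh: "x = L2_class M g" "(g, h) \<in> G" using * by metis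
    note S = graph_closureD(1,2)[OF gh(2)]
    have "sqrt (sqnorm M h) \<le> sqrt (4 * K * sqnorm M g)" using closure_bound[OF gh(2)] by simp
    then show "vnorm (L2 M) (closure_op x) \<le> sqrt (4 * K) * vnorm (L2 M) x"
      using S by (simp add: gh(1) closure_op_eq[OF gh(2)] vnorm_L2_class real_sqrt_mult)
  qed
qed

end

text \<open>If the norms of the two components are comparable and both projections of \<open>P\<close> are dense, then
  \<open>P\<close> and \<open>P\<inverse>\<close> both extend, and the closures of their graphs are converse to each other.\<close>

lemma bounded_invertible_from_graph:
  assumes "bounded_graph M P K" "bounded_graph M (P\<inverse>) K'"
  shows "\<exists>T. bounded_invertible_operator (L2 M) T \<and> (\<forall>(u, v)\<in>P. T (L2_class M u) = L2_class M v)"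
proof -
  interpret T: bounded_graph M P K by fact
  interpret S: bounded_graph M "P\<inverse>" K' by fact
  have "S.closure_op (T.closure_op x) = x \<and> T.closure_op (S.closure_op x) = x" if "x \<in> vecs (L2 M)" for x
  proof -
    obtain g where g: "g \<in> square_integrable M" "x = L2_class M g" using \<open>x \<in> vecs (L2 M)\<close> by (rule vecs_L2_E)
    obtain h where h: "(g, h) \<in> T.G" using T.closure_total[OF g(1)] by blast
    obtain k where k: "(g, k) \<in> S.G" using S.closure_total[OF g(1)] by blast
    have "(h, g) \<in> S.G" "(k, g) \<in> T.G" using h k by (simp_all add: graph_closure_converse)
    then show ?thesis using h k by (simp add: g(2) T.closure_op_eq S.closure_op_eq)
  qed
  moreover have "T.closure_op (L2_class M u) = L2_class M v" if "(u, v) \<in> P" for u v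
    using T.closure_op_eq[OF T.closure_subset[OF that]] .
  ultimately show ?thesis
    unfolding bounded_invertible_operator_def
    using T.bounded_closure_op S.bounded_closure_op by blast
qed

section \<open>A criterion for Riesz bases\<close>

definition complete_in_L2 :: "'a measure \<Rightarrow> ('a \<Rightarrow> complex) set \<Rightarrow> bool" where
  "complete_in_L2 M E \<longleftrightarrow>
     (\<forall>g\<in>square_integrable M. \<forall>\<epsilon>>0. \<exists>s\<in>span_on (space M) E. sqnorm M (g - s) < \<epsilon>)"

lemma complete_in_L2_span:
  assumes "complete_in_L2 M E" "g \<in> square_integrable M" "0 < \<epsilon>"
  obtains s where "s \<in> fun_space.span E" "sqnorm M (g - s) < \<epsilon>"
proof -
  from assms obtain s where s: "s \<in> span_on (space M) E" "sqnorm M (g - s) < \<epsilon>"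
    by (auto simp: complete_in_L2_def)
  from s(1) obtain s' where s': "s' \<in> fun_space.span E" "\<And>x. x \<in> space M \<Longrightarrow> s x = s' x"
    by (auto simp: span_on_def)
  have "sqnorm M (g - s') = sqnorm M (g - s)" by (rule sqnorm_cong) (simp add: s')
  with s s' that show ?thesis by metis
qed

abbreviation lincomb :: "'i set \<Rightarrow> ('i \<Rightarrow> complex) \<Rightarrow> ('i \<Rightarrow> 'a \<Rightarrow> complex) \<Rightarrow> 'a \<Rightarrow> complex" where
  "lincomb F a e \<equiv> (\<Sum>i\<in>F. (\<lambda>x. a i * e i x))"

lemma lincomb_extend:
  assumes "finite G" "F \<subseteq> G"
  shows "lincomb F a e = lincomb G (\<lambda>i. if i \<in> F then a i else 0) e"
  by (rule sum.mono_neutral_cong_left) (use assms in \<open>auto simp: zero_fun_def\<close>)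

lemma lincomb_in_span: "F \<subseteq> I \<Longrightarrow> lincomb F a e \<in> fun_space.span (e ` I)"
  by (intro fun_space.span_sum fun_space.span_scale fun_space.span_base) auto

lemma span_image_lincomb:
  assumes "s \<in> fun_space.span (e ` I)"
  obtains F a where "finite F" "F \<subseteq> I" "s = lincomb F a e"
proof -
  from assms obtain t r where t: "finite t" "t \<subseteq> e ` I" "s = (\<Sum>a\<in>t. (\<lambda>x. r a * a x))"
    unfolding fun_space.span_explicit by auto
  from t(2) obtain F where F: "F \<subseteq> I" "inj_on e F" "t = e ` F" by (auto simp: subset_image_inj)
  show ?thesis
  proof (rule that)
    show "finite F" using t(1) F finite_image_iff by blast
    show "s = lincomb F (r \<circ> e) e" unfolding t(3) F(3) using F(2) by (simp add: sum.reindex)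
  qed (rule F(1))
qed

lemma integrable_mult_sqint:
  assumes "f \<in> square_integrable M" "g \<in> square_integrable M"
  shows "integrable M (\<lambda>x. f x * cnj (g x))"
proof (rule Bochner_Integration.integrable_bound)
  show "integrable M (\<lambda>x. (cmod (f x))\<^sup>2 + (cmod (g x))\<^sup>2)"
    using assms by (auto intro: sqint_integrable)
  have "cnj \<in> borel_measurable borel"
    by (intro borel_measurable_continuous_onI continuous_intros)
  note [measurable] = this assms[THEN sqint_measurable]
  show "(\<lambda>x. f x * cnj (g x)) \<in> borel_measurable M" by measurable
  have "p * q \<le> p\<^sup>2 + q\<^sup>2" if "0 \<le> p" "0 \<le> q" for p q :: real
    using sum_squares_bound[of p q] that zero_le_mult_iff[of p q] by linarith
  then show "AE x in M. norm (f x * cnj (g x)) \<le> norm ((cmod (f x))\<^sup>2 + (cmod (g x))\<^sup>2)"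
    by (auto simp: norm_mult)
qed

lemma sqnorm_orthonormal_sum:
  assumes "finite F" "\<And>i. i \<in> F \<Longrightarrow> e i \<in> square_integrable M"
    and orth: "\<And>i j. i \<in> F \<Longrightarrow> j \<in> F \<Longrightarrow> (\<integral>x. e i x * cnj (e j x) \<partial>M) = (if i = j then 1 else 0)"
  shows "sqnorm M (lincomb F a e) = (\<Sum>i\<in>F. (cmod (a i))\<^sup>2)"
proof -
  note int = integrable_mult_sqint[OF assms(2) assms(2)]
  have "complex_of_real (sqnorm M (lincomb F a e)) =
      (\<integral>x. complex_of_real ((cmod (lincomb F a e x))\<^sup>2) \<partial>M)"
    unfolding sqnorm_def by (rule integral_complex_of_real[symmetric])
  also have "\<dots> = (\<integral>x. (\<Sum>i\<in>F. \<Sum>j\<in>F. (a i * cnj (a j)) * (e i x * cnj (e j x))) \<partial>M)"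
    by (rule Bochner_Integration.integral_cong[OF refl])
       (simp only: complex_norm_square sum_fun_apply cnj_sum sum_product complex_cnj_mult, 
        simp add: algebra_simps)
  also have "\<dots> = (\<Sum>i\<in>F. \<Sum>j\<in>F. (a i * cnj (a j)) * (\<integral>x. e i x * cnj (e j x) \<partial>M))"
    using int by simp
  also have "\<dots> = (\<Sum>i\<in>F. \<Sum>j\<in>F. if i = j then complex_of_real ((cmod (a i))\<^sup>2) else 0)"
    by (intro sum.cong refl) (simp_all add: orth complex_norm_square del: of_real_power)
  also have "\<dots> = complex_of_real (\<Sum>i\<in>F. (cmod (a i))\<^sup>2)"
    using assms(1) by simp
  finally show ?thesis by (simp only: of_real_eq_iff)
qed

lemma span_imp_vspan:
  assumes "\<And>i. i \<in> I \<Longrightarrow> e i \<in> square_integrable M" "s \<in> fun_space.span (e ` I)"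
  shows "L2_class M s \<in> vspan (L2 M) ((\<lambda>i. L2_class M (e i)) ` I)"
proof -
  from assms(2) have "s \<in> square_integrable M \<and> L2_class M s \<in> vspan (L2 M) ((\<lambda>i. L2_class M (e i)) ` I)"
  proof (induction rule: fun_space.span_induct_alt)
    case base
    then show ?case using vspan.zero[of "L2 M"] sqint_zero by (simp add: vzero_L2 zero_fun_def)
  next
    case (step c f y)
    then obtain i where i: "i \<in> I" "f = e i" by blast
    have f: "f \<in> square_integrable M" "(\<lambda>x. c * f x) \<in> square_integrable M"
      using assms(1) i by (auto intro: square_integrable_scale)
    have "vadd (L2 M) (vscale (L2 M) c (L2_class M f)) (L2_class M y)
        \<in> vspan (L2 M) ((\<lambda>i. L2_class M (e i)) ` I)"
      by (rule vspan.add[OF vspan.scale[OF vspan.base] conjunct2[OF step.IH]]) (use i in blast)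
    then show ?case using f step sqint_add[OF f(2)]
      by (simp add: vscale_L2_class vadd_L2_class plus_fun_def)
  qed
  then show ?thesis ..
qed

lemma orthonormal_basis_L2:
  assumes e: "\<And>i. i \<in> I \<Longrightarrow> e i \<in> square_integrable M"
    and orth: "\<And>i j. i \<in> I \<Longrightarrow> j \<in> I \<Longrightarrow> (\<integral>x. e i x * cnj (e j x) \<partial>M) = (if i = j then 1 else 0)"
    and dense: "complete_in_L2 M (e ` I)"
  shows "orthonormal_basis (L2 M) I (\<lambda>i. L2_class M (e i))"
  unfolding orthonormal_basis_def
proof (intro conjI ballI allI impI)
  show "(\<lambda>i. L2_class M (e i)) ` I \<subseteq> vecs (L2 M)" using e by (auto intro: L2_class_in_vecs)
  show "vinner (L2 M) (L2_class M (e i)) (L2_class M (e j)) = (if i = j then 1 else 0)"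
    if "i \<in> I" "j \<in> I" for i j using that by (simp add: vinner_L2_class e orth)
  fix x and \<epsilon> :: real assume x: "x \<in> vecs (L2 M)" and "0 < \<epsilon>"
  from x obtain g where g: "g \<in> square_integrable M" "x = L2_class M g" by (rule vecs_L2_E)
  from \<open>0 < \<epsilon>\<close> have "0 < \<epsilon>\<^sup>2" by simp
  with dense g(1) obtain s where s: "s \<in> fun_space.span (e ` I)" "sqnorm M (g - s) < \<epsilon>\<^sup>2"
    by (rule complete_in_L2_span)
  have "s \<in> square_integrable M" using s(1) e by (intro sqint_span[of "e ` I"]) auto
  then have "vdist (L2 M) x (L2_class M s) < \<epsilon>"
    using s(2) g \<open>0 < \<epsilon>\<close> real_sqrt_less_mono[OF s(2)] by (simp add: vdist_L2_class)
  then show "\<exists>y\<in>vspan (L2 M) ((\<lambda>i. L2_class M (e i)) ` I). vdist (L2 M) x y < \<epsilon>"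
    using span_imp_vspan[OF e s(1)] by blast
qed

text \<open>The operator maps \<open>e i\<close> to \<open>f i\<close>: the pairs of corresponding finite linear combinations form a
  graph to which the closure construction applies, because the norm of a combination of the
  \<open>e i\<close> is given by its coefficients. The norm bounds for \<open>f\<close> give boundedness in both directions,
  completeness of \<open>e\<close> and \<open>f\<close> gives density of both projections.\<close>

theorem riesz_basis_L2I:
  fixes e f :: "'i \<Rightarrow> 'a \<Rightarrow> complex"
  assumes "countable I"
    and e: "\<And>i. i \<in> I \<Longrightarrow> e i \<in> square_integrable M"
    and orth: "\<And>i j. i \<in> I \<Longrightarrow> j \<in> I \<Longrightarrow> (\<integral>x. e i x * cnj (e j x) \<partial>M) = (if i = j then 1 else 0)"
    and e_complete: "complete_in_L2 M (e ` I)"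
    and f: "\<And>i. i \<in> I \<Longrightarrow> f i \<in> square_integrable M"
    and f_complete: "complete_in_L2 M (f ` I)"
    and K: "0 \<le> K"
    and upper: "\<And>F a. finite F \<Longrightarrow> F \<subseteq> I \<Longrightarrow> sqnorm M (lincomb F a f) \<le> K * (\<Sum>i\<in>F. (cmod (a i))\<^sup>2)"
    and lower: "\<And>F a. finite F \<Longrightarrow> F \<subseteq> I \<Longrightarrow> (\<Sum>i\<in>F. (cmod (a i))\<^sup>2) \<le> K * sqnorm M (lincomb F a f)"
  shows "riesz_basis (L2 M) I (\<lambda>i. L2_class M (f i))"
proof -
  define P where "P = {(lincomb F a e, lincomb F a f) | F a. finite F \<and> F \<subseteq> I}"
  have P: "P \<subseteq> square_integrable M \<times> square_integrable M"
  proof -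
    have "lincomb F a g \<in> square_integrable M"
      if "F \<subseteq> I" "\<And>i. i \<in> I \<Longrightarrow> g i \<in> square_integrable M" for F a and g :: "'i \<Rightarrow> 'a \<Rightarrow> complex"
      by (rule sqint_span[of "g ` I"]) (use that in \<open>auto intro: lincomb_in_span\<close>)
    then show ?thesis using e f by (auto simp: P_def)
  qed
  have PI: "(lincomb F a e, lincomb F a f) \<in> P" if "finite F" "F \<subseteq> I" for F a
    using that unfolding P_def by blast
  have P_add: "(u + u', v + v') \<in> P" if "(u, v) \<in> P" "(u', v') \<in> P" for u v u' v'
  proof -
    from that obtain F a F' a' where F: "finite F" "F \<subseteq> I" "u = lincomb F a e" "v = lincomb F a f"
      "finite F'" "F' \<subseteq> I" "u' = lincomb F' a' e" "v' = lincomb F' a' f" by (auto simp: P_def)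
    define b where "b i = (if i \<in> F then a i else 0) + (if i \<in> F' then a' i else 0)" for i
    have "lincomb F a g + lincomb F' a' g = lincomb (F \<union> F') b g" for g :: "'i \<Rightarrow> 'a \<Rightarrow> complex"
    proof -
      have "lincomb F a g + lincomb F' a' g = lincomb (F \<union> F') (\<lambda>i. if i \<in> F then a i else 0) g
          + lincomb (F \<union> F') (\<lambda>i. if i \<in> F' then a' i else 0) g"
        using F(1,5) by (intro arg_cong2[where f = plus] lincomb_extend) auto
      also have "\<dots> = lincomb (F \<union> F') b g"
        unfolding sum.distrib[symmetric] b_def by (intro sum.cong refl) (simp add: fun_eq_iff distrib_right)
      finally show ?thesis .
    qed
    then show ?thesis using F(1,2,5,6) unfolding F(3,4,7,8) by (simp only: PI finite_UnI Un_least)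
  qed
  have P_scale: "((\<lambda>x. c * u x), (\<lambda>x. c * v x)) \<in> P" if "(u, v) \<in> P" for u v c
  proof -
    from that obtain F a where F: "finite F" "F \<subseteq> I" "u = lincomb F a e" "v = lincomb F a f" by (auto simp: P_def)
    have "(\<lambda>x. c * lincomb F a g x) = lincomb F (\<lambda>i. c * a i) g" for g :: "'i \<Rightarrow> 'a \<Rightarrow> complex"
      by (rule ext, subst (1 2) sum_fun_apply) (simp only: sum_distrib_left mult.assoc)
    then show ?thesis using F(1,2) unfolding F(3,4) by (simp only: PI)
  qed
  have parseval: "sqnorm M (lincomb F a e) = (\<Sum>i\<in>F. (cmod (a i))\<^sup>2)" if "finite F" "F \<subseteq> I" for F a
    using that by (intro sqnorm_orthonormal_sum e orth) auto
  have 1: "bounded_graph M P K"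
  proof (unfold_locales)
    show "\<exists>u v. (u, v) \<in> P \<and> sqnorm M (g - u) < \<epsilon>" if g: "g \<in> square_integrable M" and \<epsilon>: "0 < \<epsilon>" for g \<epsilon>
    proof -
      obtain s where s: "s \<in> fun_space.span (e ` I)" "sqnorm M (g - s) < \<epsilon>"
        using e_complete g \<epsilon> by (rule complete_in_L2_span)
      from s(1) obtain F a where "finite F" "F \<subseteq> I" "s = lincomb F a e" by (rule span_image_lincomb)
      with s(2) show ?thesis by (auto simp: P_def)
    qed
    show "sqnorm M v \<le> K * sqnorm M u" if "(u, v) \<in> P" for u v
      using that upper by (auto simp: P_def parseval)
  qed (rule P P_add P_scale K; assumption)+
  have 2: "bounded_graph M (P\<inverse>) K"
  proof (unfold_locales)
    show "\<exists>u v. (u, v) \<in> P\<inverse> \<and> sqnorm M (g - u) < \<epsilon>" if g: "g \<in> square_integrable M" and \<epsilon>: "0 < \<epsilon>" for g \<epsilon>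
    proof -
      obtain s where s: "s \<in> fun_space.span (f ` I)" "sqnorm M (g - s) < \<epsilon>"
        using f_complete g \<epsilon> by (rule complete_in_L2_span)
      from s(1) obtain F a where "finite F" "F \<subseteq> I" "s = lincomb F a f" by (rule span_image_lincomb)
      with s(2) show ?thesis by (auto simp: P_def)
    qed
    show "sqnorm M v \<le> K * sqnorm M u" if "(u, v) \<in> P\<inverse>" for u v
      using that lower by (auto simp: P_def parseval)
    show "P\<inverse> \<subseteq> square_integrable M \<times> square_integrable M" using P by blast
    show "(u + u', v + v') \<in> P\<inverse>" if "(u, v) \<in> P\<inverse>" "(u', v') \<in> P\<inverse>" for u v u' v'
      using P_add that by blast
    show "((\<lambda>x. c * u x), (\<lambda>x. c * v x)) \<in> P\<inverse>" if "(u, v) \<in> P\<inverse>" for u v c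
      using P_scale that by blast
  qed (rule K)
  obtain T where T: "bounded_invertible_operator (L2 M) T" "\<forall>(u, v)\<in>P. T (L2_class M u) = L2_class M v"
    using bounded_invertible_from_graph[OF 1 2] by blast
  have "L2_class M (f i) = T (L2_class M (e i))" if "i \<in> I" for i
  proof -
    have "(lincomb {i} (\<lambda>_. 1) e, lincomb {i} (\<lambda>_. 1) f) \<in> P" using that by (intro PI) auto
    then show ?thesis using T(2) by auto
  qed
  with T(1) orthonormal_basis_L2[OF e orth e_complete] \<open>countable I\<close> show ?thesis
    unfolding riesz_basis_def by blast
qed

lemma riesz_basis_reindex:
  assumes "inj_on p I" "riesz_basis H I (\<lambda>i. g (p i))"
  shows "riesz_basis H (p ` I) g"
proof -
  from assms(2) obtain T e where T: "bounded_invertible_operator H T" "orthonormal_basis H I e"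
    "\<forall>i\<in>I. g (p i) = T (e i)" and I: "countable I" by (auto simp: riesz_basis_def)
  define q where "q = the_inv_into I p"
  have q: "q (p i) = i" if "i \<in> I" for i using assms(1) that by (simp add: q_def the_inv_into_f_f)
  have im: "(e \<circ> q) ` p ` I = e ` I" using q by (force simp: image_iff)
  have "orthonormal_basis H (p ` I) (e \<circ> q)"
    using T(2) assms(1) unfolding orthonormal_basis_def im by (auto simp: q dest: inj_onD)
  moreover have "\<forall>l\<in>p ` I. g l = T ((e \<circ> q) l)" using T(3) q by auto
  ultimately show ?thesis using T(1) I unfolding riesz_basis_def by blast
qed

section \<open>Open subgroups and their cosets\<close>

definition open_subgroup :: "'a::topological_ab_group_add set \<Rightarrow> bool" where
  "open_subgroup W \<longleftrightarrow> open W \<and> 0 \<in> W \<and> (\<forall>x\<in>W. \<forall>y\<in>W. x - y \<in> W)"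

definition coset :: "'a::ab_group_add \<Rightarrow> 'a set \<Rightarrow> 'a set" where
  "coset a W = {x. x - a \<in> W}"

lemma mem_coset: "x \<in> coset a W \<longleftrightarrow> x - a \<in> W"
  by (simp add: coset_def)

lemma coset_eq_image: "coset a W = (+) a ` W"
  by (force simp: coset_def image_iff)

context
  fixes W :: "'a::topological_ab_group_add set"
  assumes W: "open_subgroup W"
begin

lemma open_subgroup_zero: "0 \<in> W"
  using W by (auto simp: open_subgroup_def)

lemma open_subgroup_diff: "x \<in> W \<Longrightarrow> y \<in> W \<Longrightarrow> x - y \<in> W"
  using W by (auto simp: open_subgroup_def)

lemma open_subgroup_minus: "x \<in> W \<Longrightarrow> - x \<in> W"
  using open_subgroup_diff[OF open_subgroup_zero] by simp

lemma open_subgroup_add: "x \<in> W \<Longrightarrow> y \<in> W \<Longrightarrow> x + y \<in> W"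
  using open_subgroup_diff[OF _ open_subgroup_minus] by simp

lemma coset_self: "a \<in> coset a W"
  by (simp add: mem_coset open_subgroup_zero)

lemma coset_eq_iff: "coset a W = coset b W \<longleftrightarrow> a - b \<in> W"
proof
  assume "coset a W = coset b W"
  with coset_self[of a] show "a - b \<in> W" by (simp add: mem_coset)
next
  assume ab: "a - b \<in> W"
  show "coset a W = coset b W" unfolding set_eq_iff mem_coset
  proof (intro allI iffI)
    fix x
    show "x - b \<in> W" if "x - a \<in> W" using open_subgroup_add[OF that ab] by simp
    show "x - a \<in> W" if "x - b \<in> W" using open_subgroup_diff[OF that ab] by simp
  qed
qed

lemma mem_coset_imp_eq: "x \<in> coset a W \<Longrightarrow> coset x W = coset a W"
  by (simp add: coset_eq_iff mem_coset)

lemma open_coset: "open (coset a W)"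
proof -
  have "open ((\<lambda>x. x - a) -` W)"
    by (rule open_vimage) (use W in \<open>auto simp: open_subgroup_def intro!: continuous_intros\<close>)
  then show ?thesis by (simp add: coset_def vimage_def)
qed

lemma finite_transversal:
  assumes "compact K"
  obtains A where "finite A" "A \<subseteq> K" "K \<subseteq> (\<Union>a\<in>A. coset a W)"
    "\<And>a b. a \<in> A \<Longrightarrow> b \<in> A \<Longrightarrow> a - b \<in> W \<Longrightarrow> a = b"
proof -
  obtain A0 where A0: "A0 \<subseteq> K" "finite A0" "K \<subseteq> (\<Union>a\<in>A0. coset a W)"
    by (rule compactE_image[OF assms, of K "\<lambda>a. coset a W"]) (use open_coset coset_self in auto)
  have "(\<lambda>a. coset a W) ` A0 \<subseteq> (\<lambda>a. coset a W) ` A0" by simp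
  then obtain A where A: "A \<subseteq> A0" "inj_on (\<lambda>a. coset a W) A" "(\<lambda>a. coset a W) ` A0 = (\<lambda>a. coset a W) ` A"
    unfolding subset_image_inj by blast
  show ?thesis
  proof (rule that)
    show "finite A" "A \<subseteq> K" using A A0 finite_subset by auto
    show "K \<subseteq> (\<Union>a\<in>A. coset a W)" using A0(3) A(3) by metis
    show "a = b" if "a \<in> A" "b \<in> A" "a - b \<in> W" for a b
      using inj_onD[OF A(2) _ that(1,2)] that(3) by (simp add: coset_eq_iff)
  qed
qed

end

text \<open>The balls around 0 of an invariant ultrametric are used only through these properties.\<close>

locale filtered_group =
  fixes U :: "nat \<Rightarrow> 'a::topological_ab_group_add set"
  assumes open_subgroup_U: "open_subgroup (U n)"
    and U_decreasing: "m \<le> n \<Longrightarrow> U n \<subseteq> U m"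
    and U_base: "open V \<Longrightarrow> x \<in> V \<Longrightarrow> \<exists>n. coset x (U n) \<subseteq> V"
begin

text \<open>For \<open>K = V = \<Omega>\<close> this shows that a compact open set is a union of cosets of a single
  open subgroup. The reason is the Lebesgue number argument, in which two cosets of nested
  subgroups are nested or disjoint.\<close>

lemma uniform_coset_neighbourhood:
  assumes "compact K" "open V" "K \<subseteq> V"
  obtains n where "\<And>x. x \<in> K \<Longrightarrow> coset x (U n) \<subseteq> V"
proof -
  have "\<forall>x\<in>K. \<exists>n. coset x (U n) \<subseteq> V" using U_base assms(2,3) by blast
  then obtain n where n: "\<And>x. x \<in> K \<Longrightarrow> coset x (U (n x)) \<subseteq> V" by metis
  obtain A where A: "A \<subseteq> K" "finite A" "K \<subseteq> (\<Union>a\<in>A. coset a (U (n a)))"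
    by (rule compactE_image[OF assms(1), of K "\<lambda>a. coset a (U (n a))"])
       (use open_coset[OF open_subgroup_U] coset_self[OF open_subgroup_U] in auto)
  define N where "N = Max (insert 0 (n ` A))"
  show ?thesis
  proof (rule that[of N])
    fix x assume "x \<in> K"
    then obtain a where a: "a \<in> A" "x \<in> coset a (U (n a))" using A(3) by blast
    have "n a \<le> N" unfolding N_def using A(2) a(1) by (intro Max_ge) auto
    then have "coset x (U N) \<subseteq> coset x (U (n a))" using U_decreasing[of "n a" N] by (auto simp: mem_coset)
    also have "coset x (U (n a)) = coset a (U (n a))" using mem_coset_imp_eq[OF open_subgroup_U a(2)] .
    also have "\<dots> \<subseteq> V" using n a A(1) by blast
    finally show "coset x (U N) \<subseteq> V" .
  qed
qed

end

lemma non_archimedean_filtration: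
  assumes "non_archimedean_group TYPE('a::topological_ab_group_add)"
  shows "\<exists>U :: nat \<Rightarrow> 'a set. filtered_group U"
proof -
  from assms obtain d :: "'a \<Rightarrow> 'a \<Rightarrow> real" where d: "Metric_space UNIV d"
    "Metric_space.mtopology UNIV d = euclidean"
    and ultra: "\<And>x y z. d x z \<le> max (d x y) (d y z)" and inv: "\<And>g x y. d (g + x) (g + y) = d x y"
    unfolding non_archimedean_group_def by blast
  interpret Metric_space UNIV d by (rule d(1))
  have ball: "coset x {y. d 0 y < r} = mball x r" for x r
  proof -
    have "d 0 (y - x) = d x y" for y using inv[of x 0 "y - x"] by simp
    then show ?thesis by (simp add: coset_def mball_def)
  qed
  have op: "open (mball x r)" for x r
    using openin_mball[of x r] unfolding d(2) by simp
  define U where "U n = {y. d 0 y < inverse (real (Suc n))}" for n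
  have "filtered_group U"
  proof
    fix n
    have "coset 0 (U n) = U n" by (simp add: coset_def)
    then have "open (U n)" using op[of 0 "inverse (real (Suc n))"] ball[of 0 "inverse (real (Suc n))"]
      by (simp add: U_def)
    moreover have "x - y \<in> U n" if "x \<in> U n" "y \<in> U n" for x y
    proof -
      have "d 0 (x - y) = d y x" using inv[of y 0 "x - y"] by simp
      then show ?thesis using ultra[of y x 0] that commute[of y 0] by (auto simp: U_def)
    qed
    ultimately show "open_subgroup (U n)" by (simp add: open_subgroup_def) (simp add: U_def)
  next
    fix m n :: nat assume "m \<le> n"
    then have "inverse (real (Suc n)) \<le> inverse (real (Suc m))" by (simp add: field_simps)
    then show "U n \<subseteq> U m" unfolding U_def using order_less_le_trans by blast
  next
    fix V and x :: 'a assume "open V" "x \<in> V"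
    then obtain r where r: "r > 0" "mball x r \<subseteq> V"
      using openin_mtopology[of V] unfolding d(2) by auto
    obtain n where n: "inverse (real (Suc n)) < r" using reals_Archimedean[OF r(1)] by auto
    have "coset x (U n) \<subseteq> mball x r"
      unfolding U_def ball using n by (auto simp: mball_def)
    then show "\<exists>n. coset x (U n) \<subseteq> V" using r(2) by blast
  qed
  then show ?thesis by blast
qed

section \<open>Characters separate points from open subgroups\<close>

text \<open>Homomorphisms from subgroups to the circle are represented by their graphs, which are subgroups of
  the product; extension is inclusion, so Zorn's lemma applies to unions of chains. The last clause
  expresses that the relation is single valued.\<close>

definition circle_hom_graph :: "('a::ab_group_add \<times> complex) set \<Rightarrow> bool" where
  "circle_hom_graph S \<longleftrightarrow> (0, 1) \<in> S \<and> (\<forall>x z. (x, z) \<in> S \<longrightarrow> cmod z = 1) \<and>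
     (\<forall>x z y w. (x, z) \<in> S \<longrightarrow> (y, w) \<in> S \<longrightarrow> (x - y, z / w) \<in> S) \<and> (\<forall>z. (0, z) \<in> S \<longrightarrow> z = 1)"

lemma circle_hom_graphD:
  assumes "circle_hom_graph S"
  shows "(0, 1) \<in> S" "(x, z) \<in> S \<Longrightarrow> cmod z = 1" "(x, z) \<in> S \<Longrightarrow> (y, w) \<in> S \<Longrightarrow> (x - y, z / w) \<in> S"
    "(0, z) \<in> S \<Longrightarrow> z = 1"
  using assms unfolding circle_hom_graph_def by blast+

lemma circle_hom_graph_minus: "circle_hom_graph S \<Longrightarrow> (x, z) \<in> S \<Longrightarrow> (- x, 1 / z) \<in> S"
  using circle_hom_graphD(3)[of S 0 1 x z] circle_hom_graphD(1) by auto

lemma circle_hom_graph_add: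
  "circle_hom_graph S \<Longrightarrow> (x, z) \<in> S \<Longrightarrow> (y, w) \<in> S \<Longrightarrow> (x + y, z * w) \<in> S"
  using circle_hom_graphD(3)[of S x z "- y" "1 / w"] circle_hom_graph_minus[of S y w] by auto

lemma circle_hom_graph_unique:
  assumes "circle_hom_graph S" "(x, z) \<in> S" "(x, w) \<in> S" shows "z = w"
proof -
  have "(0, z / w) \<in> S" using circle_hom_graphD(3)[OF assms(1,2,3)] by simp
  then have "z / w = 1" by (rule circle_hom_graphD(4)[OF assms(1)])
  then show ?thesis by (auto simp: divide_eq_1_iff)
qed

definition multiple :: "nat \<Rightarrow> 'a::ab_group_add \<Rightarrow> 'a" where
  "multiple n y = (\<Sum>i<n. y)"

lemma multiple_0 [simp]: "multiple 0 y = 0" and multiple_Suc: "multiple (Suc n) y = multiple n y + y"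
  by (simp_all add: multiple_def)

lemma multiple_add: "multiple (m + n) y = multiple m y + multiple n y"
  by (induction n) (simp_all add: multiple_Suc add.assoc)

lemma circle_hom_graph_multiple:
  "circle_hom_graph S \<Longrightarrow> (y, w) \<in> S \<Longrightarrow> (multiple n y, w ^ n) \<in> S"
  by (induction n) (simp_all add: multiple_Suc circle_hom_graphD(1) circle_hom_graph_add power_Suc2 del: power_Suc)

lemma multiple_multiple: "multiple (m * n) y = multiple m (multiple n y)"
  by (induction m) (simp_all add: multiple_Suc multiple_add add.commute)

text \<open>This is where the divisibility of the circle enters. If no positive multiple
  of \<open>y\<close> lies in the domain, every \<open>v\<close> on the circle is compatible. Otherwise let \<open>m\<close> be the least such multiple; the compatible \<open>v\<close> are the
  \<open>m\<close>-th roots of the value at \<open>m y\<close>. As \<open>y\<close> itself is outside the domain, \<open>m \<ge> 2\<close>, so at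
  least one of these roots is different from 1; this is what allows characters to separate points.\<close>

lemma exists_compatible_value:
  assumes S: "circle_hom_graph S" and y: "y \<notin> fst ` S"
  obtains v where "cmod v = 1" "v \<noteq> 1" "\<And>n w. (multiple n y, w) \<in> S \<Longrightarrow> w = v ^ n"
proof (cases "\<exists>n>0. multiple n y \<in> fst ` S")
  case False
  show ?thesis
  proof (rule that[of "-1"])
    fix n w assume *: "(multiple n y, w) \<in> S"
    with False have "n = 0" by force
    with * circle_hom_graphD(4)[OF S] show "w = (-1) ^ n" by simp
  qed auto
next
  case True
  define m where "m = (LEAST n. n > 0 \<and> multiple n y \<in> fst ` S)"
  have m: "m > 0 \<and> multiple m y \<in> fst ` S" unfolding m_def using True by (rule LeastI_ex)
  have least: "\<not> (n > 0 \<and> multiple n y \<in> fst ` S)" if "n < m" for n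
    using that unfolding m_def by (rule not_less_Least)
  obtain w0 where w0: "(multiple m y, w0) \<in> S" using m by force
  have "m \<noteq> 1" using m y by (metis multiple_0 multiple_Suc One_nat_def add_0)
  with m have "2 \<le> m" by simp
  have "cmod w0 = 1" using circle_hom_graphD(2)[OF S w0] .
  then have "w0 \<noteq> 0" by auto
  then have "card {v. v ^ m = w0} = m" using m by (intro card_nth_roots) auto
  then have "\<not> {v. v ^ m = w0} \<subseteq> {1}" using card_mono[of "{1::complex}" "{v. v ^ m = w0}"] \<open>2 \<le> m\<close> by auto
  then obtain v where v: "v ^ m = w0" "v \<noteq> 1" by blast
  have "cmod v ^ m = 1" using v(1) \<open>cmod w0 = 1\<close> by (simp flip: norm_power)
  then have "cmod v = 1" using m by (intro power_eq_imp_eq_base[of "cmod v" m 1]) auto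
  show ?thesis
  proof (rule that[OF \<open>cmod v = 1\<close> v(2)])
    fix n w assume *: "(multiple n y, w) \<in> S"
    have n: "n = n div m * m + n mod m" by simp
    have q: "(multiple (n div m * m) y, w0 ^ (n div m)) \<in> S"
      unfolding multiple_multiple by (rule circle_hom_graph_multiple[OF S w0])
    have "multiple (n mod m) y = multiple n y - multiple (n div m * m) y"
      using multiple_add[of "n div m * m" "n mod m" y] by simp
    with circle_hom_graphD(3)[OF S * q] have "multiple (n mod m) y \<in> fst ` S" by force
    then have "n mod m = 0" using least[of "n mod m"] m by auto
    with n have "n div m * m = n" by linarith
    with q have "(multiple n y, v ^ n) \<in> S" using v(1) by (metis mult.commute power_mult)
    with * show "w = v ^ n" by (rule circle_hom_graph_unique[OF S])
  qed
qed

lemma circle_hom_graph_extend: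
  assumes S: "circle_hom_graph S" and y: "y \<notin> fst ` S"
  obtains S' v where "circle_hom_graph S'" "S \<subseteq> S'" "(y, v) \<in> S'" "v \<noteq> 1"
proof -
  obtain v where v: "cmod v = 1" "v \<noteq> 1" and comp: "\<And>n w. (multiple n y, w) \<in> S \<Longrightarrow> w = v ^ n"
    using exists_compatible_value[OF S y] by blast
  have v0: "v \<noteq> 0" using v(1) by auto
  define S' where "S' = {(x + multiple j y - multiple k y, z * v ^ j / v ^ k) | x z j k. (x, z) \<in> S}"
  have S'I: "(x + multiple j y - multiple k y, z * v ^ j / v ^ k) \<in> S'" if "(x, z) \<in> S" for x z j k
    using that unfolding S'_def by blast
  have sub: "S \<subseteq> S'"
  proof
    fix p assume "p \<in> S"
    then show "p \<in> S'" using S'I[of "fst p" "snd p" 0 0] by simp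
  qed
  moreover have "circle_hom_graph S'" unfolding circle_hom_graph_def
  proof (intro conjI allI impI)
    show "(0, 1) \<in> S'" using circle_hom_graphD(1)[OF S] sub by blast
    show "cmod c = 1" if "(a, c) \<in> S'" for a c
    proof -
      obtain x z j k where "c = z * v ^ j / v ^ k" "(x, z) \<in> S"
        using \<open>(a, c) \<in> S'\<close> unfolding S'_def by blast
      then show ?thesis using v(1) circle_hom_graphD(2)[OF S] by (simp add: norm_mult norm_divide norm_power)
    qed
    show "(a - b, c / e) \<in> S'" if ac: "(a, c) \<in> S'" and be: "(b, e) \<in> S'" for a c b e
    proof -
      obtain x z j k where 1: "a = x + multiple j y - multiple k y" "c = z * v ^ j / v ^ k" "(x, z) \<in> S"
        using ac unfolding S'_def by blast
      obtain x' z' j' k' where 2: "b = x' + multiple j' y - multiple k' y" "e = z' * v ^ j' / v ^ k'" "(x', z') \<in> S"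
        using be unfolding S'_def by blast
      have "z' \<noteq> 0" using circle_hom_graphD(2)[OF S 2(3)] by auto
      then have "c / e = (z / z') * v ^ (j + k') / v ^ (k + j')"
        using v0 by (simp add: 1 2 field_simps power_add)
      moreover have "a - b = (x - x') + multiple (j + k') y - multiple (k + j') y"
        by (simp add: 1 2 multiple_add algebra_simps)
      ultimately show ?thesis using S'I[OF circle_hom_graphD(3)[OF S 1(3) 2(3)]] by simp
    qed
    show "c = 1" if "(0, c) \<in> S'" for c
    proof -
      obtain x z j k where 1: "0 = x + multiple j y - multiple k y" "c = z * v ^ j / v ^ k" "(x, z) \<in> S"
        using \<open>(0, c) \<in> S'\<close> unfolding S'_def by blast
      have z0: "z \<noteq> 0" using circle_hom_graphD(2)[OF S 1(3)] by auto
      show ?thesis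
      proof (cases "j \<le> k")
        case True
        then have "multiple (k - j) y = x" using 1(1) multiple_add[of j "k - j" y] by (simp add: algebra_simps)
        then have "z = v ^ (k - j)" using comp 1(3) by blast
        then have "z * v ^ j = v ^ k" using True by (simp flip: power_add)
        then show ?thesis using 1(2) v0 by simp
      next
        case False
        then have "multiple (j - k) y = - x" using 1(1) multiple_add[of k "j - k" y]
          by (simp add: algebra_simps eq_neg_iff_add_eq_0)
        then have "1 / z = v ^ (j - k)" using comp circle_hom_graph_minus[OF S 1(3)] by metis
        then have "v ^ j = v ^ k / z" using False
          by (metis le_add_diff_inverse nat_le_linear power_add times_divide_eq_right mult.right_neutral)
        then show ?thesis using 1(2) v0 z0 by simp
      qed
    qed
  qed
  moreover have "(y, v) \<in> S'" using S'I[OF circle_hom_graphD(1)[OF S], of 1 0] by (simp add: multiple_def)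
  ultimately show ?thesis using that v(2) by blast
qed

lemma circle_hom_graph_total_extension:
  assumes S: "circle_hom_graph S"
  obtains T where "circle_hom_graph T" "S \<subseteq> T" "fst ` T = UNIV"
proof -
  let ?A = "{T. circle_hom_graph T \<and> S \<subseteq> T}"
  have "\<exists>T\<in>?A. \<forall>X\<in>?A. T \<subseteq> X \<longrightarrow> X = T"
  proof (rule subset_Zorn_nonempty)
    show "?A \<noteq> {}" using S by blast
    fix \<C> assume "\<C> \<noteq> {}" "subset.chain ?A \<C>"
    then have C: "\<And>T. T \<in> \<C> \<Longrightarrow> circle_hom_graph T" "\<And>T. T \<in> \<C> \<Longrightarrow> S \<subseteq> T"
      and lin: "\<And>T T'. T \<in> \<C> \<Longrightarrow> T' \<in> \<C> \<Longrightarrow> T \<subseteq> T' \<or> T' \<subseteq> T"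
      by (auto simp: subset_chain_def)
    have "circle_hom_graph (\<Union>\<C>)" unfolding circle_hom_graph_def
    proof (intro conjI allI impI)
      show "(0, 1) \<in> \<Union>\<C>" using C(2) circle_hom_graphD(1)[OF S] \<open>\<C> \<noteq> {}\<close> by blast
      show "cmod z = 1" if "(x, z) \<in> \<Union>\<C>" for x z using that C(1) circle_hom_graphD(2) by blast
      show "z = 1" if "(0, z) \<in> \<Union>\<C>" for z using that C(1) circle_hom_graphD(4) by blast
      fix x z y w assume "(x, z) \<in> \<Union>\<C>" "(y, w) \<in> \<Union>\<C>"
      then obtain T where "T \<in> \<C>" "(x, z) \<in> T" "(y, w) \<in> T" using lin by blast
      then show "(x - y, z / w) \<in> \<Union>\<C>" using circle_hom_graphD(3)[OF C(1)] by blast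
    qed
    then show "\<Union>\<C> \<in> ?A" using C(2) \<open>\<C> \<noteq> {}\<close> by blast
  qed
  then obtain T where TA: "T \<in> ?A" and maxA: "\<forall>X\<in>?A. T \<subseteq> X \<longrightarrow> X = T"
    by (rule bexE)
  from TA have T: "circle_hom_graph T" "S \<subseteq> T" by auto
  have max: "X = T" if "circle_hom_graph X" "S \<subseteq> X" "T \<subseteq> X" for X
    using maxA that by simp
  have "y \<in> fst ` T" for y
  proof (rule ccontr)
    assume y: "y \<notin> fst ` T"
    obtain X v where X: "circle_hom_graph X" "T \<subseteq> X" "(y, v) \<in> X"
      using circle_hom_graph_extend[OF T(1) y] by blast
    then have "X = T" using T(2) by (intro max) auto
    with X(3) y show False by force
  qed
  with T that show ?thesis by blast
qed

text \<open>An extension of a character that is trivial on an open subgroup needs no topological care.\<close>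

lemma locally_constant_continuous:
  fixes f :: "'a::topological_ab_group_add \<Rightarrow> 'b::topological_space"
  assumes "open_subgroup W" "\<And>x y. y - x \<in> W \<Longrightarrow> f y = f x"
  shows "continuous_on UNIV f"
  unfolding continuous_on_def
proof
  fix x
  have "\<forall>\<^sub>F y in at x. f y = f x"
    unfolding eventually_at_topological
    using open_coset[OF assms(1), of x] coset_self[OF assms(1), of x] assms(2) by (auto simp: mem_coset)
  then show "(f \<longlongrightarrow> f x) (at x)" by (rule tendsto_eventually)
qed

lemma characterD:
  assumes "\<gamma> \<in> characters"
  shows "continuous_on UNIV \<gamma>" "cmod (\<gamma> x) = 1" "\<gamma> (x + y) = \<gamma> x * \<gamma> y" "\<gamma> x \<noteq> 0" "\<gamma> 0 = 1"
    "\<gamma> (x - y) = \<gamma> x / \<gamma> y" "\<gamma> x * cnj (\<gamma> x) = 1"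
proof -
  show 1: "continuous_on UNIV \<gamma>" "cmod (\<gamma> x) = 1" and 2: "\<gamma> (x + y) = \<gamma> x * \<gamma> y" for x y
    using assms by (auto simp: characters_def)
  show 3: "\<gamma> x \<noteq> 0" for x using 1(2)[of x] by auto
  show "\<gamma> 0 = 1" using 2[of 0 0] 3[of 0] by simp
  show "\<gamma> (x - y) = \<gamma> x / \<gamma> y" using 2[of "x - y" y] 3[of y] by (simp add: field_simps)
  show "\<gamma> x * cnj (\<gamma> x) = 1" using complex_norm_square[of "\<gamma> x"] 1(2)[of x] by simp
qed

lemma character_mult: "\<gamma> \<in> characters \<Longrightarrow> \<delta> \<in> characters \<Longrightarrow> (\<lambda>x. \<gamma> x * \<delta> x) \<in> characters"
  by (auto simp: characters_def norm_mult intro!: continuous_intros)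

lemma character_one: "(\<lambda>x. 1) \<in> characters"
  by (auto simp: characters_def)

lemma character_separates:
  assumes W: "open_subgroup W" and x: "x \<notin> W"
  obtains \<gamma> where "\<gamma> \<in> characters" "\<And>u. u \<in> W \<Longrightarrow> \<gamma> u = 1" "\<gamma> x \<noteq> 1"
proof -
  have "circle_hom_graph (W \<times> {1})"
    using open_subgroup_zero[OF W] open_subgroup_diff[OF W] by (auto simp: circle_hom_graph_def)
  moreover have "x \<notin> fst ` (W \<times> {1::complex})" using x by auto
  ultimately obtain S v where S: "circle_hom_graph S" "W \<times> {1} \<subseteq> S" "(x, v) \<in> S" "v \<noteq> 1"
    by (rule circle_hom_graph_extend)
  from S(1) obtain T where T: "circle_hom_graph T" "S \<subseteq> T" "fst ` T = UNIV"
    by (rule circle_hom_graph_total_extension)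
  have "\<forall>y. \<exists>z. (y, z) \<in> T" using T(3) by (force simp: set_eq_iff image_iff)
  then obtain \<gamma> where \<gamma>: "\<And>y. (y, \<gamma> y) \<in> T" by metis
  have val: "\<gamma> y = z" if "(y, z) \<in> T" for y z
    using circle_hom_graph_unique[OF T(1) \<gamma> that] .
  have W1: "\<gamma> u = 1" if "u \<in> W" for u using that S(2) T(2) by (intro val) auto
  have add: "\<gamma> (a + b) = \<gamma> a * \<gamma> b" for a b
    by (rule val) (rule circle_hom_graph_add[OF T(1) \<gamma> \<gamma>])
  have "continuous_on UNIV \<gamma>"
  proof (rule locally_constant_continuous[OF W])
    show "\<gamma> b = \<gamma> a" if "b - a \<in> W" for a b using add[of "b - a" a] W1[OF that] by simp
  qed
  then have "\<gamma> \<in> characters"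
    using add circle_hom_graphD(2)[OF T(1) \<gamma>] by (auto simp: characters_def)
  moreover have "\<gamma> x \<noteq> 1" using val[of x v] S T(2) by auto
  ultimately show ?thesis using that W1 by blast
qed

section \<open>Linear combinations of characters\<close>

text \<open>The characters that factor through the quotient by \<open>W\<close>.\<close>

definition characters_mod :: "'a::topological_ab_group_add set \<Rightarrow> ('a \<Rightarrow> complex) set" where
  "characters_mod W = {\<gamma> \<in> characters. \<forall>u\<in>W. \<gamma> u = 1}"

lemma characters_mod_mult:
  "\<gamma> \<in> characters_mod W \<Longrightarrow> \<delta> \<in> characters_mod W \<Longrightarrow> (\<lambda>x. \<gamma> x * \<delta> x) \<in> characters_mod W"
  by (auto simp: characters_mod_def character_mult)

lemma characters_mod_const_on_coset:
  assumes "\<gamma> \<in> characters_mod W" "x \<in> coset a W" shows "\<gamma> x = \<gamma> a"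
proof -
  have "\<gamma> ((x - a) + a) = \<gamma> (x - a) * \<gamma> a" using assms(1) by (intro characterD(3)) (simp add: characters_mod_def)
  then show ?thesis using assms by (simp add: characters_mod_def mem_coset)
qed

text \<open>For every coset \<open>b + W\<close> other than \<open>a + W\<close> that meets \<open>S\<close>, there is a
  character \<open>\<gamma> b\<close> trivial on \<open>W\<close> with \<open>\<gamma> b (b - a) \<noteq> 1\<close>, and an affine function \<open>\<phi> b\<close>
  of it is 1 on \<open>a + W\<close> and 0 on \<open>b + W\<close>. By compactness finitely many \<open>b\<close> occur, and the
  product of the \<open>\<phi> b\<close> is the indicator on \<open>S\<close>. Products of characters are characters, so it
  expands into a linear combination.\<close>

lemma coset_indicator_in_span:
  fixes W :: "'a::topological_ab_group_add set"
  assumes W: "open_subgroup W" and "compact S"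
  shows "indicator (coset a W) \<in> span_on S (characters_mod W)"
proof -
  obtain A where A: "finite A" "S \<subseteq> (\<Union>b\<in>A. coset b W)"
    using finite_transversal[OF W \<open>compact S\<close>] by metis
  define B where "B = {b \<in> A. b - a \<notin> W}"
  have "finite B" using A(1) by (simp add: B_def)
  have "\<exists>\<gamma>\<in>characters_mod W. \<gamma> (b - a) \<noteq> 1" if "b \<in> B" for b
  proof -
    from that have "b - a \<notin> W" by (simp add: B_def)
    then obtain \<gamma> where "\<gamma> \<in> characters" "\<And>u. u \<in> W \<Longrightarrow> \<gamma> u = 1" "\<gamma> (b - a) \<noteq> 1"
      using character_separates[OF W] by blast
    then show ?thesis by (auto simp: characters_mod_def)
  qed
  then obtain \<gamma> where \<gamma>: "\<And>b. b \<in> B \<Longrightarrow> \<gamma> b \<in> characters_mod W" "\<And>b. b \<in> B \<Longrightarrow> \<gamma> b (b - a) \<noteq> 1"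
    by metis
  define \<phi> where "\<phi> b x = (\<gamma> b (x - a) - \<gamma> b (b - a)) / (1 - \<gamma> b (b - a))" for b x
  have prod_in: "(\<lambda>x. \<Prod>b\<in>B'. \<phi> b x) \<in> span_on S (characters_mod W)" if "finite B'" "B' \<subseteq> B" for B'
    using that
  proof (induction B')
    case empty
    show ?case by (rule span_on_base) (simp add: characters_mod_def character_one)
  next
    case (insert b B')
    have b: "\<gamma> b \<in> characters_mod W" using insert.prems \<gamma>(1) by simp
    then have bc: "\<gamma> b \<in> characters" by (simp add: characters_mod_def)
    define c where "c = 1 / (1 - \<gamma> b (b - a))"
    have "(\<lambda>x. \<phi> b x * (\<Prod>b\<in>B'. \<phi> b x)) \<in> span_on S (characters_mod W)"
    proof (rule span_on_mult)
      show "(\<lambda>x. \<Prod>b\<in>B'. \<phi> b x) \<in> span_on S (characters_mod W)" using insert by simp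
      fix f assume f: "f \<in> characters_mod W"
      have "(\<lambda>x. (c / \<gamma> b a) * (\<gamma> b x * f x)) + (\<lambda>x. (- (c * \<gamma> b (b - a))) * f x)
          \<in> span_on S (characters_mod W)"
        by (intro span_on_add span_on_scale span_on_base characters_mod_mult b f)
      then show "(\<lambda>x. \<phi> b x * f x) \<in> span_on S (characters_mod W)"
      proof (rule span_on_cong)
        fix x
        have "\<phi> b x = c * (\<gamma> b x / \<gamma> b a - \<gamma> b (b - a))"
          using characterD(6)[OF bc, of x a] by (simp add: \<phi>_def c_def)
        then show "\<phi> b x * f x = ((\<lambda>x. (c / \<gamma> b a) * (\<gamma> b x * f x)) + (\<lambda>x. (- (c * \<gamma> b (b - a))) * f x)) x"
          by (simp add: right_diff_distrib left_diff_distrib)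
      qed
    qed
    then show ?case using insert.hyps by simp
  qed
  show ?thesis
  proof (rule span_on_cong[OF prod_in[OF \<open>finite B\<close> subset_refl]])
    fix x assume "x \<in> S"
    show "indicator (coset a W) x = (\<Prod>b\<in>B. \<phi> b x)"
    proof (cases "x \<in> coset a W")
      case True
      have "\<phi> b x = 1" if "b \<in> B" for b
        using \<gamma>[OF that] True by (simp add: \<phi>_def characters_mod_def mem_coset)
      then show ?thesis using True by simp
    next
      case False
      obtain b where b: "b \<in> A" "x \<in> coset b W" using A(2) \<open>x \<in> S\<close> by blast
      have "b - a \<notin> W"
        using False mem_coset_imp_eq[OF W b(2)] coset_self[OF W, of x] coset_eq_iff[OF W, of b a] by auto
      then have "b \<in> B" using b(1) by (simp add: B_def)
      have "x - a \<in> coset (b - a) W" using b(2) by (simp add: mem_coset)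
      then have "\<phi> b x = 0"
        using characters_mod_const_on_coset[OF \<gamma>(1)[OF \<open>b \<in> B\<close>]] by (simp add: \<phi>_def)
      then show ?thesis using False \<open>b \<in> B\<close> \<open>finite B\<close> by (auto simp: prod_zero_iff)
    qed
  qed
qed

text \<open>If the restrictions of \<open>P\<close> to the finite set \<open>A\<close> span all functions on \<open>A\<close>, some of them form a
  basis. A basis has as many elements as the basis of point masses, so it can be indexed by \<open>A\<close>, and \<open>C\<close> is the
  matrix of coordinates of the point masses. The two equations say that \<open>C\<close> is a right and a
  left inverse of the matrix with entries \<open>\<psi> k l\<close>.\<close>

lemma unisolvent_subfamily:
  fixes P :: "('a \<Rightarrow> complex) set"
  assumes A: "finite A" and P: "\<And>a. a \<in> A \<Longrightarrow> indicator {a} \<in> span_on A P"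
  obtains \<psi> :: "'a \<Rightarrow> 'a \<Rightarrow> complex" and C :: "'a \<Rightarrow> 'a \<Rightarrow> complex"
  where "\<And>k. k \<in> A \<Longrightarrow> \<psi> k \<in> P"
    and "\<And>l x. l \<in> A \<Longrightarrow> x \<in> A \<Longrightarrow> (\<Sum>k\<in>A. C k l * \<psi> k x) = (if x = l then 1 else 0)"
    and "\<And>k k'. k \<in> A \<Longrightarrow> k' \<in> A \<Longrightarrow> (\<Sum>l\<in>A. C k l * \<psi> k' l) = (if k = k' then 1 else 0)"
proof -
  define \<delta> :: "'a \<Rightarrow> 'a \<Rightarrow> complex" where "\<delta> a = indicator {a}" for a
  define r :: "('a \<Rightarrow> complex) \<Rightarrow> 'a \<Rightarrow> complex" where "r g = (\<lambda>x. indicator A x * g x)" for g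
  have r_span: "r s \<in> fun_space.span (r ` P)" if "s \<in> fun_space.span P" for s
    using that
  proof (induction rule: fun_space.span_induct_alt)
    case base
    show ?case using fun_space.span_zero[of "r ` P"] by (simp add: r_def zero_fun_def)
  next
    case (step c f y)
    have "r ((\<lambda>x. c * f x) + y) = (\<lambda>x. c * r f x) + r y"
      by (rule ext) (simp add: r_def algebra_simps)
    moreover have "(\<lambda>x. c * r f x) + r y \<in> fun_space.span (r ` P)"
      by (intro fun_space.span_add fun_space.span_scale fun_space.span_base imageI step)
    ultimately show ?case by (simp only:)
  qed
  have \<delta>_span: "\<delta> a \<in> fun_space.span (r ` P)" if a: "a \<in> A" for a
  proof -
    obtain s where s: "s \<in> fun_space.span P" "\<And>x. x \<in> A \<Longrightarrow> \<delta> a x = s x"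
      using P[OF a] by (auto simp: span_on_def \<delta>_def)
    have "\<delta> a = r s"
    proof
      fix x
      show "\<delta> a x = r s x"
      proof (cases "x \<in> A")
        case True
        then show ?thesis by (simp add: r_def s(2))
      next
        case False
        then show ?thesis using a by (auto simp: r_def \<delta>_def indicator_def)
      qed
    qed
    then show ?thesis using r_span[OF s(1)] by simp
  qed
  obtain B where B: "B \<subseteq> r ` P" "\<not> fun_space.dependent B" "r ` P \<subseteq> fun_space.span B"
    using fun_space.maximal_independent_subset by blast
  have \<delta>_B: "\<delta> a \<in> fun_space.span B" if "a \<in> A" for a
    using \<delta>_span[OF that] fun_space.span_minimal[OF B(3) fun_space.subspace_span] by blast
  have inj: "inj_on \<delta> A"
    by (rule inj_onI) (metis \<delta>_def indicator_simps(1) indicator_simps(2) insertI1 one_neq_zero singletonD)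
  have expand: "g = (\<Sum>a\<in>A. (\<lambda>x. g a * \<delta> a x))" if "\<And>x. x \<notin> A \<Longrightarrow> g x = 0" for g
  proof
    fix x
    have "(\<Sum>a\<in>A. (\<lambda>x. g a * \<delta> a x)) x = (\<Sum>a\<in>A. if a = x then g a else 0)"
      unfolding sum_fun_apply by (rule sum.cong) (auto simp: \<delta>_def indicator_def)
    also have "\<dots> = g x" using A that by auto
    finally show "g x = (\<Sum>a\<in>A. (\<lambda>x. g a * \<delta> a x)) x" ..
  qed
  have B_vanish: "b x = 0" if "b \<in> B" "x \<notin> A" for b x using that B(1) by (auto simp: r_def)
  have B_expand: "b = (\<Sum>a\<in>A. (\<lambda>x. b a * \<delta> a x))" if "b \<in> B" for b
    using B_vanish that by (intro expand) auto
  have "B \<subseteq> fun_space.span (\<delta> ` A)"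
  proof
    fix b assume "b \<in> B"
    show "b \<in> fun_space.span (\<delta> ` A)"
      by (subst B_expand[OF \<open>b \<in> B\<close>])
         (intro fun_space.span_sum fun_space.span_scale fun_space.span_base imageI)
  qed
  with A B(2) have fin: "finite B" and "card B \<le> card (\<delta> ` A)"
    using fun_space.independent_span_bound[of "\<delta> ` A" B] by auto
  moreover have "\<not> fun_space.dependent (\<delta> ` A)"
  proof
    assume "fun_space.dependent (\<delta> ` A)"
    then obtain u v where u: "v \<in> \<delta> ` A" "u v \<noteq> 0" "(\<Sum>v\<in>\<delta> ` A. (\<lambda>x. u v * v x)) = 0"
      using A by (subst (asm) fun_space.dependent_finite) auto
    then obtain a where a: "a \<in> A" "v = \<delta> a" by blast
    have "0 = (\<Sum>v\<in>\<delta> ` A. (\<lambda>x. u v * v x)) a" using u(3) by simp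
    also have "\<dots> = (\<Sum>a'\<in>A. u (\<delta> a') * \<delta> a' a)" unfolding sum_fun_apply using inj by (simp add: sum.reindex)
    also have "\<dots> = (\<Sum>a'\<in>A. if a' = a then u (\<delta> a') else 0)"
      by (rule sum.cong) (auto simp: \<delta>_def indicator_def)
    also have "\<dots> = u v" using A a by simp
    finally show False using u(2) by simp
  qed
  then have "card (\<delta> ` A) \<le> card B"
    using fun_space.independent_span_bound[OF fin, of "\<delta> ` A"] \<delta>_B by blast
  ultimately have "card A = card B" using inj by (simp add: card_image)
  then obtain \<beta> where \<beta>: "bij_betw \<beta> A B" using A fin finite_same_card_bij by blast
  have "\<exists>p\<in>P. r p = \<beta> k" if "k \<in> A" for k using \<beta> B(1) that by (force simp: bij_betw_def)
  then obtain \<psi> where \<psi>: "\<And>k. k \<in> A \<Longrightarrow> \<psi> k \<in> P" "\<And>k. k \<in> A \<Longrightarrow> r (\<psi> k) = \<beta> k" by metis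
  have \<psi>_eq: "\<psi> k x = \<beta> k x" if "k \<in> A" "x \<in> A" for k x
    using \<psi>(2)[OF that(1), symmetric] that(2) by (simp add: r_def)
  have \<beta>B: "\<beta> k \<in> B" if "k \<in> A" for k using \<beta> that by (auto simp: bij_betw_def)
  define C where "C k l = fun_space.representation B (\<delta> l) (\<beta> k)" for k l
  show ?thesis
  proof (rule that[OF \<psi>(1)])
    fix l x assume lx: "l \<in> A" "x \<in> A"
    have "(\<Sum>b\<in>B. (\<lambda>x. fun_space.representation B (\<delta> l) b * b x)) = \<delta> l"
      by (rule fun_space.sum_representation_eq[OF B(2) \<delta>_B[OF lx(1)] fin subset_refl])
    then have "(\<Sum>b\<in>B. fun_space.representation B (\<delta> l) b * b x) = \<delta> l x"
      by (metis (no_types, lifting) sum_fun_apply sum.cong)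
    moreover have "(\<Sum>k\<in>A. C k l * \<psi> k x) = (\<Sum>k\<in>A. fun_space.representation B (\<delta> l) (\<beta> k) * \<beta> k x)"
      by (rule sum.cong) (simp_all add: C_def \<psi>_eq lx)
    moreover have "\<dots> = (\<Sum>b\<in>B. fun_space.representation B (\<delta> l) b * b x)"
      by (rule sum.reindex_bij_betw[OF \<beta>])
    ultimately show "(\<Sum>k\<in>A. C k l * \<psi> k x) = (if x = l then 1 else 0)"
      by (simp add: \<delta>_def indicator_def)
  next
    fix k k' assume k: "k \<in> A" "k' \<in> A"
    have "(if k = k' then 1 else 0) = fun_space.representation B (\<beta> k') (\<beta> k)"
      using fun_space.representation_basis[OF B(2) \<beta>B[OF k(2)]] \<beta> k by (auto simp: bij_betw_def inj_on_def)
    also have "\<dots> = fun_space.representation B (\<Sum>a\<in>A. (\<lambda>x. \<beta> k' a * \<delta> a x)) (\<beta> k)"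
      using B_expand[OF \<beta>B[OF k(2)]] by simp
    also have "\<dots> = (\<Sum>l\<in>A. fun_space.representation B (\<lambda>x. \<beta> k' l * \<delta> l x) (\<beta> k))"
      by (subst fun_space.representation_sum[OF B(2)]) (auto intro: fun_space.span_scale \<delta>_B)
    also have "\<dots> = (\<Sum>l\<in>A. C k l * \<psi> k' l)"
      by (rule sum.cong) (simp_all add: fun_space.representation_scale[OF B(2) \<delta>_B] C_def \<psi>_eq k)
    finally show "(\<Sum>l\<in>A. C k l * \<psi> k' l) = (if k = k' then 1 else 0)" ..
  qed
qed

section \<open>Closures of spans in \<open>L\<^sup>2\<close>\<close>

definition L2_closure :: "'a measure \<Rightarrow> ('a \<Rightarrow> complex) set \<Rightarrow> ('a \<Rightarrow> complex) set" where
  "L2_closure M E = {g \<in> square_integrable M. \<forall>\<epsilon>>0. \<exists>s\<in>fun_space.span E. sqnorm M (g - s) < \<epsilon>}"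

lemma L2_closureD:
  assumes "g \<in> L2_closure M E"
  shows "g \<in> square_integrable M" "0 < \<epsilon> \<Longrightarrow> \<exists>s\<in>fun_space.span E. sqnorm M (g - s) < \<epsilon>"
  using assms unfolding L2_closure_def by blast+

context
  fixes M :: "'a measure" and E :: "('a \<Rightarrow> complex) set"
  assumes E: "E \<subseteq> square_integrable M"
begin

lemma L2_closure_span: "s \<in> fun_space.span E \<Longrightarrow> s \<in> L2_closure M E"
  using sqint_span[OF E] by (auto simp: L2_closure_def intro!: bexI[of _ s])

lemma L2_closure_limit:
  assumes g: "g \<in> square_integrable M"
    and lim: "\<And>\<epsilon>. 0 < \<epsilon> \<Longrightarrow> \<exists>h\<in>L2_closure M E. sqnorm M (g - h) < \<epsilon>"
  shows "g \<in> L2_closure M E"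
proof -
  have "\<exists>s\<in>fun_space.span E. sqnorm M (g - s) < \<epsilon>" if "0 < \<epsilon>" for \<epsilon>
  proof -
    have \<epsilon>: "0 < \<epsilon> / 4" using that by simp
    obtain h where h: "h \<in> L2_closure M E" "sqnorm M (g - h) < \<epsilon> / 4" using lim[OF \<epsilon>] by blast
    obtain s where s: "s \<in> fun_space.span E" "sqnorm M (h - s) < \<epsilon> / 4"
      using L2_closureD(2)[OF h(1) \<epsilon>] by blast
    have "sqnorm M (g - s) < \<epsilon>"
      using sqnorm_diff_le[OF g _ sqint_span[OF E s(1)], of h] h s by (simp add: L2_closure_def)
    with s(1) show ?thesis by blast
  qed
  with g show ?thesis by (simp add: L2_closure_def)
qed

lemma L2_closure_add:
  assumes "g \<in> L2_closure M E" "h \<in> L2_closure M E" shows "g + h \<in> L2_closure M E"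
proof -
  have "\<exists>s\<in>fun_space.span E. sqnorm M ((g + h) - s) < \<epsilon>" if "0 < \<epsilon>" for \<epsilon>
  proof -
    have \<epsilon>: "0 < \<epsilon> / 4" using that by simp
    obtain s where s: "s \<in> fun_space.span E" "sqnorm M (g - s) < \<epsilon> / 4"
      using L2_closureD(2)[OF assms(1) \<epsilon>] by blast
    obtain t where t: "t \<in> fun_space.span E" "sqnorm M (h - t) < \<epsilon> / 4"
      using L2_closureD(2)[OF assms(2) \<epsilon>] by blast
    have eq: "(g - s) + (h - t) = (g + h) - (s + t)" by (simp add: algebra_simps)
    have "sqnorm M ((g - s) + (h - t)) \<le> 2 * sqnorm M (g - s) + 2 * sqnorm M (h - t)"
      by (intro sqnorm_add_le sqint_diff sqint_span[OF E] s(1) t(1) L2_closureD(1)[OF assms(1)]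
          L2_closureD(1)[OF assms(2)])
    then have "sqnorm M ((g + h) - (s + t)) < \<epsilon>" unfolding eq using s(2) t(2) by linarith
    with fun_space.span_add[OF s(1) t(1)] show ?thesis by blast
  qed
  then show ?thesis using assms by (simp add: L2_closure_def sqint_add)
qed

lemma L2_closure_scale:
  assumes "g \<in> L2_closure M E" shows "(\<lambda>x. c * g x) \<in> L2_closure M E"
proof -
  have "\<exists>s\<in>fun_space.span E. sqnorm M ((\<lambda>x. c * g x) - s) < \<epsilon>" if "0 < \<epsilon>" for \<epsilon>
  proof -
    obtain \<delta> where \<delta>: "0 < \<delta>"
      and small: "\<And>p q. sqnorm M (p - q) < \<delta> \<Longrightarrow> sqnorm M ((\<lambda>x. c * p x) - (\<lambda>x. c * q x)) < \<epsilon>"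
      using sqnorm_scale_small[OF \<open>0 < \<epsilon>\<close>, of M c] by blast
    obtain s where s: "s \<in> fun_space.span E" "sqnorm M (g - s) < \<delta>"
      using L2_closureD(2)[OF assms \<delta>] by blast
    show ?thesis using fun_space.span_scale[OF s(1), of c] small[OF s(2)] by blast
  qed
  then show ?thesis using assms by (simp add: L2_closure_def square_integrable_scale)
qed

lemma L2_closure_sum:
  assumes "\<And>i. i \<in> I \<Longrightarrow> g i \<in> L2_closure M E" shows "(\<Sum>i\<in>I. g i) \<in> L2_closure M E"
  using assms
proof (induction I rule: infinite_finite_induct)
  case (insert i I)
  have "g i + (\<Sum>i\<in>I. g i) \<in> L2_closure M E" by (intro L2_closure_add insert) (use insert in auto)
  then show ?case using insert.hyps by (simp only: sum.insert not_False_eq_True)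
qed (use L2_closure_span[OF fun_space.span_zero] in simp_all)

lemma L2_closure_cong:
  assumes "g \<in> L2_closure M E" "h \<in> square_integrable M" "\<And>x. x \<in> space M \<Longrightarrow> h x = g x"
  shows "h \<in> L2_closure M E"
proof -
  have "sqnorm M (h - s) = sqnorm M (g - s)" for s by (rule sqnorm_cong) (simp add: assms(3))
  then show ?thesis using assms(1,2) by (simp add: L2_closure_def)
qed

end

lemma bounded_sqint:
  assumes "finite_measure M" "f \<in> borel_measurable M" "\<And>x. x \<in> space M \<Longrightarrow> cmod (f x) \<le> c"
  shows "f \<in> square_integrable M"
proof -
  interpret finite_measure M by fact
  note [measurable] = assms(2)
  have "integrable M (\<lambda>x. (cmod (f x))\<^sup>2)"
    by (rule integrable_const_bound[of _ "c\<^sup>2"]) (use assms(3) in \<open>auto intro!: power_mono\<close>)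
  then show ?thesis using assms(2) by (simp add: square_integrable_def)
qed

text \<open>On a finite measure space, simple functions are dense in \<open>L\<^sup>2\<close> by dominated convergence;
  hence it suffices to approximate indicators.\<close>

lemma complete_in_L2_indicatorI:
  assumes fin: "finite_measure M" and E: "E \<subseteq> square_integrable M"
    and ind: "\<And>B. B \<in> sets M \<Longrightarrow> indicator B \<in> L2_closure M E"
  shows "complete_in_L2 M E"
proof -
  have simple: "f \<in> L2_closure M E" if f: "simple_function M f" for f
  proof (rule L2_closure_cong[OF E])
    have ran: "finite (f ` space M)" and sets: "\<And>y. f -` {y} \<inter> space M \<in> sets M"
      using f by (auto simp: simple_function_def intro: simple_functionD(2)[OF f])
    show "(\<Sum>y\<in>f ` space M. (\<lambda>x. y * indicator (f -` {y} \<inter> space M) x)) \<in> L2_closure M E"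
      by (intro L2_closure_sum[OF E] L2_closure_scale[OF E] ind sets)
    show "f x = (\<Sum>y\<in>f ` space M. (\<lambda>x. y * indicator (f -` {y} \<inter> space M) x)) x"
      if x: "x \<in> space M" for x
    proof -
      have "(\<Sum>y\<in>f ` space M. y * indicator (f -` {y} \<inter> space M) x)
          = (\<Sum>y\<in>f ` space M. if y = f x then f x else 0)"
        by (rule sum.cong) (use x in \<open>auto simp: indicator_def\<close>)
      also have "\<dots> = f x" using ran x by simp
      finally show ?thesis by (simp add: sum_fun_apply)
    qed
    have "f x \<in> f ` space M" if "x \<in> space M" for x using that by blast
    then have "cmod (f x) \<le> (\<Sum>y\<in>f ` space M. cmod y)" if "x \<in> space M" for x
      using that ran by (intro member_le_sum) auto
    then show "f \<in> square_integrable M"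
      using bounded_sqint[OF fin borel_measurable_simple_function[OF f]] by blast
  qed
  have "g \<in> L2_closure M E" if g: "g \<in> square_integrable M" for g
  proof (rule L2_closure_limit[OF E g])
    note [measurable] = sqint_measurable[OF g]
    obtain F where F: "\<And>i. simple_function M (F i)" "\<And>x. x \<in> space M \<Longrightarrow> (\<lambda>i. F i x) \<longlonglongrightarrow> g x"
      "\<And>i x. x \<in> space M \<Longrightarrow> dist (F i x) 0 \<le> 2 * dist (g x) 0"
      using borel_measurable_implies_sequence_metric[OF sqint_measurable[OF g], of 0] by blast
    note [measurable] = borel_measurable_simple_function[OF F(1)]
    have "(\<lambda>i. sqnorm M (g - F i)) \<longlonglongrightarrow> (\<integral>x. 0 \<partial>M)" unfolding sqnorm_def
    proof (rule integral_dominated_convergence[where w = "\<lambda>x. 9 * (cmod (g x))\<^sup>2"])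
      show "integrable M (\<lambda>x. 9 * (cmod (g x))\<^sup>2)" using sqint_integrable[OF g] by simp
      show "AE x in M. (\<lambda>i. (cmod ((g - F i) x))\<^sup>2) \<longlonglongrightarrow> 0"
      proof (rule AE_I2)
        fix x assume "x \<in> space M"
        have "(\<lambda>i. (cmod (g x - F i x))\<^sup>2) \<longlonglongrightarrow> (cmod (g x - g x))\<^sup>2"
          by (intro tendsto_intros F(2)) fact
        then show "(\<lambda>i. (cmod ((g - F i) x))\<^sup>2) \<longlonglongrightarrow> 0" by simp
      qed
      show "AE x in M. norm ((cmod ((g - F i) x))\<^sup>2) \<le> 9 * (cmod (g x))\<^sup>2" for i
      proof (rule AE_I2)
        fix x assume "x \<in> space M"
        have "cmod (g x - F i x) \<le> 3 * cmod (g x)"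
          using norm_triangle_ineq4[of "g x" "F i x"] F(3)[OF \<open>x \<in> space M\<close>, of i] by simp
        then have "(cmod (g x - F i x))\<^sup>2 \<le> (3 * cmod (g x))\<^sup>2" by (intro power_mono) auto
        then show "norm ((cmod ((g - F i) x))\<^sup>2) \<le> 9 * (cmod (g x))\<^sup>2" by (simp add: power_mult_distrib)
      qed
    qed (simp_all add: fun_diff_def)
    then have lim: "(\<lambda>i. sqnorm M (g - F i)) \<longlonglongrightarrow> 0" by simp
    fix \<epsilon> :: real assume "0 < \<epsilon>"
    then have "\<forall>\<^sub>F i in sequentially. sqnorm M (g - F i) < \<epsilon>" by (rule order_tendstoD(2)[OF lim])
    then obtain i where "sqnorm M (g - F i) < \<epsilon>" by (auto simp: eventually_sequentially)
    then show "\<exists>h\<in>L2_closure M E. sqnorm M (g - h) < \<epsilon>" using simple[OF F(1)] by blast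
  qed
  then show ?thesis
    unfolding complete_in_L2_def L2_closure_def by (blast intro: span_onI)
qed

lemma complete_in_L2_trans:
  assumes "complete_in_L2 M E" "E \<subseteq> span_on (space M) F" shows "complete_in_L2 M F"
  using assms span_on_trans[OF assms(2)] unfolding complete_in_L2_def by blast

section \<open>Haar measure\<close>

locale haar_filtered_group = filtered_group U for U :: "nat \<Rightarrow> 'a::topological_ab_group_add set" +
  fixes \<mu> :: "'a measure"
  assumes haar: "haar_measure \<mu>"
begin

lemma sets_mu [measurable_cong, simp]: "sets \<mu> = sets borel"
  using haar by (simp add: haar_measure_def)

lemma space_mu [simp]: "space \<mu> = UNIV"
  using sets_eq_imp_space_eq[OF sets_mu] by simp

lemma emeasure_translate: "A \<in> sets borel \<Longrightarrow> emeasure \<mu> ((+) g ` A) = emeasure \<mu> A"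
  using haar by (simp add: haar_measure_def)

lemma emeasure_compact: "compact K \<Longrightarrow> emeasure \<mu> K < \<infinity>"
  using haar by (simp add: haar_measure_def)

lemma emeasure_coset:
  assumes "open_subgroup W" shows "emeasure \<mu> (coset a W) = emeasure \<mu> W"
  using assms unfolding coset_eq_image by (intro emeasure_translate) (auto simp: open_subgroup_def)

text \<open>Compact sets are covered by finitely many cosets. If \<open>W\<close> were a null set, then so would be every
  compact set and, by inner regularity, the whole group.\<close>

lemma emeasure_open_subgroup_pos:
  assumes W: "open_subgroup W" shows "emeasure \<mu> W \<noteq> 0"
proof
  assume 0: "emeasure \<mu> W = 0"
  have "emeasure \<mu> K = 0" if "compact K" for K
  proof -
    obtain A where A: "finite A" "K \<subseteq> (\<Union>a\<in>A. coset a W)" using finite_transversal[OF W \<open>compact K\<close>] by metis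
    have "emeasure \<mu> K \<le> emeasure \<mu> (\<Union>a\<in>A. coset a W)"
      using A open_coset[OF W] by (intro emeasure_mono) (auto intro!: borel_open)
    also have "\<dots> \<le> (\<Sum>a\<in>A. emeasure \<mu> (coset a W))"
      using A(1) open_coset[OF W] by (intro emeasure_subadditive_finite) auto
    also have "\<dots> = 0" by (simp add: emeasure_coset[OF W] 0)
    finally show ?thesis by simp
  qed
  moreover have "emeasure \<mu> UNIV = (SUP K\<in>{K. compact K \<and> K \<subseteq> UNIV}. emeasure \<mu> K)"
    using haar unfolding haar_measure_def by blast
  ultimately have "emeasure \<mu> UNIV = (SUP K\<in>{K::'a set. compact K}. 0)" by simp
  also have "\<dots> = 0" by (rule cSUP_const) (auto intro: exI[of _ "{}"])
  finally show False using haar by (simp add: haar_measure_def)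
qed

lemma integral_translate:
  fixes f :: "'a \<Rightarrow> complex"
  assumes [measurable]: "f \<in> borel_measurable borel"
  shows "(\<integral>x. f (x + g) \<partial>\<mu>) = (\<integral>x. f x \<partial>\<mu>)"
proof -
  have m [measurable]: "(\<lambda>x. x + g) \<in> borel_measurable borel"
    by (intro borel_measurable_continuous_onI continuous_intros)
  have "distr \<mu> borel (\<lambda>x. x + g) = \<mu>"
  proof (rule measure_eqI)
    fix A assume "A \<in> sets (distr \<mu> borel (\<lambda>x. x + g))"
    then have A: "A \<in> sets borel" by simp
    have "(\<lambda>x. x + g) -` A = (+) (- g) ` A" by (force simp: image_iff)
    then show "emeasure (distr \<mu> borel (\<lambda>x. x + g)) A = emeasure \<mu> A"
      using A emeasure_translate[OF A, of "- g"] by (simp add: emeasure_distr)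
  qed simp
  then show ?thesis using integral_distr[of "\<lambda>x. x + g" \<mu> borel f] by simp
qed

text \<open>Translating by \<open>h\<close> multiplies the integrand by the constant \<open>\<gamma> h / \<delta> h \<noteq> 1\<close> and does not
  change the integral.\<close>

lemma character_orthogonality:
  assumes W: "open_subgroup W" and \<gamma>: "\<gamma> \<in> characters" and \<delta>: "\<delta> \<in> characters"
    and h: "h \<in> W" "\<gamma> h \<noteq> \<delta> h"
  shows "(\<integral>x. indicator (coset a W) x * (\<gamma> x * cnj (\<delta> x)) \<partial>\<mu>) = 0"
proof -
  define f where "f x = indicator (coset a W) x * (\<gamma> x * cnj (\<delta> x))" for x
  define q where "q = \<gamma> h * cnj (\<delta> h)"
  have [measurable]: "coset a W \<in> sets borel" using open_coset[OF W] by simp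
  have "(\<lambda>x. \<gamma> x * cnj (\<delta> x)) \<in> borel_measurable borel"
    using characterD(1)[OF \<gamma>] characterD(1)[OF \<delta>]
    by (intro borel_measurable_continuous_onI continuous_intros)
  then have f: "f \<in> borel_measurable borel" unfolding f_def by measurable
  have "q \<noteq> 1"
  proof
    assume "q = 1"
    then have "\<gamma> h * (\<delta> h * cnj (\<delta> h)) = \<delta> h" by (simp add: q_def mult.left_commute mult.commute)
    then show False using h(2) characterD(7)[OF \<delta>] by simp
  qed
  have "f (x + h) = q * f x" for x
  proof -
    have "x + h \<in> coset a W \<longleftrightarrow> x \<in> coset a W"
      using mem_coset_imp_eq[OF W, of "x + h" a] mem_coset_imp_eq[OF W, of x a] h(1)
        coset_self[OF W] coset_eq_iff[OF W, of "x + h" x] by auto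
    then show ?thesis
      by (simp add: f_def q_def characterD(3)[OF \<gamma>] characterD(3)[OF \<delta>] indicator_def)
  qed
  then have "(\<integral>x. f x \<partial>\<mu>) = q * (\<integral>x. f x \<partial>\<mu>)" using integral_translate[OF f, of h] by simp
  then show ?thesis using \<open>q \<noteq> 1\<close> by (simp add: f_def)
qed

lemma character_norm:
  assumes "open_subgroup W" and "\<gamma> \<in> characters"
  shows "(\<integral>x. indicator (coset a W) x * (\<gamma> x * cnj (\<gamma> x)) \<partial>\<mu>) = measure \<mu> W"
proof -
  have "(\<integral>x. indicator (coset a W) x * (\<gamma> x * cnj (\<gamma> x)) \<partial>\<mu>)
      = (\<integral>x. complex_of_real (indicator (coset a W) x) \<partial>\<mu>)"
    by (rule Bochner_Integration.integral_cong) (simp_all add: characterD(7)[OF assms(2)] indicator_def)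
  also have "\<dots> = complex_of_real (\<integral>x. indicator (coset a W) x \<partial>\<mu>)" by (rule integral_complex_of_real)
  also have "(\<integral>x. indicator (coset a W) x \<partial>\<mu>) = measure \<mu> W"
    using emeasure_coset[OF assms(1), of a] by (simp add: measure_def)
  finally show ?thesis .
qed

lemma union_of_cosets_indicator:
  assumes W: "open_subgroup W" and "finite A" and A: "\<And>a b. a \<in> A \<Longrightarrow> b \<in> A \<Longrightarrow> a - b \<in> W \<Longrightarrow> a = b"
  shows "indicator (\<Union>a\<in>A. coset a W) x = (\<Sum>a\<in>A. indicator (coset a W) x :: complex)"
proof (rule indicator_UN_disjoint[OF \<open>finite A\<close>])
  show "disjoint_family_on (\<lambda>a. coset a W) A"
    unfolding disjoint_family_on_def
  proof (intro ballI impI)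
    fix a b assume ab: "a \<in> A" "b \<in> A" "a \<noteq> b"
    show "coset a W \<inter> coset b W = {}"
    proof (rule ccontr)
      assume "coset a W \<inter> coset b W \<noteq> {}"
      then obtain x where "x \<in> coset a W" "x \<in> coset b W" by blast
      then have "coset a W = coset b W" using mem_coset_imp_eq[OF W] by blast
      then show False using A ab by (simp add: coset_eq_iff[OF W])
    qed
  qed
qed

end

locale haar_compact_open = haar_filtered_group U \<mu>
  for U :: "nat \<Rightarrow> 'a::topological_ab_group_add set" and \<mu> :: "'a measure" +
  fixes \<Omega> :: "'a set"
  assumes compact: "compact \<Omega>" and open_Omega: "open \<Omega>"
begin

abbreviation "\<nu> \<equiv> restrict_space \<mu> \<Omega>"

lemma Omega_sets [measurable, simp]: "\<Omega> \<in> sets borel"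
  using open_Omega by simp

lemma space_nu [simp]: "space \<nu> = \<Omega>"
  by (simp add: space_restrict_space)

lemma finite_measure_nu: "finite_measure \<nu>"
  using emeasure_compact[OF compact] by (intro finite_measureI) (simp add: emeasure_restrict_space)

lemma integral_nu:
  fixes f :: "'a \<Rightarrow> 'b::{banach, second_countable_topology}"
  shows "(\<integral>x. f x \<partial>\<nu>) = (\<integral>x. indicator \<Omega> x *\<^sub>R f x \<partial>\<mu>)"
  by (rule integral_restrict_space) simp

definition coset_indicators :: "('a \<Rightarrow> complex) set" where
  "coset_indicators = {indicator (coset a (U n)) | a n. a \<in> \<Omega>}"

lemma measurable_nu: "f \<in> borel_measurable borel \<Longrightarrow> f \<in> borel_measurable \<nu>"
  by (simp add: measurable_restrict_space1)

lemma coset_indicators_sqint: "coset_indicators \<subseteq> square_integrable \<nu>"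
proof -
  have "indicator (coset a (U n)) \<in> square_integrable \<nu>" for a n
  proof (rule bounded_sqint[OF finite_measure_nu, of _ 1])
    have [measurable]: "coset a (U n) \<in> sets borel" using open_coset[OF open_subgroup_U] by simp
    show "indicator (coset a (U n)) \<in> borel_measurable \<nu>" by (rule measurable_nu) measurable
  qed (simp add: indicator_def)
  then show ?thesis by (auto simp: coset_indicators_def)
qed

text \<open>Outer regularity gives an open set \<open>V\<close> slightly larger than \<open>B\<close>, inner regularity a compact
  set \<open>K\<close> slightly smaller than \<open>V\<close>. A finite union \<open>C\<close> of cosets of some \<open>U n\<close> fits between
  \<open>K\<close> and \<open>V\<close>, so that \<open>B\<close> and \<open>C\<close> differ by a set of small measure.\<close>

lemma indicator_in_closure:
  assumes B: "B \<in> sets borel" "B \<subseteq> \<Omega>"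
  shows "indicator B \<in> L2_closure \<nu> coset_indicators"
proof (rule L2_closure_limit[OF coset_indicators_sqint])
  note [measurable] = B(1)
  show "indicator B \<in> square_integrable \<nu>"
    by (rule bounded_sqint[OF finite_measure_nu measurable_nu, of _ 1]) (auto simp: indicator_def)
  fix \<epsilon> :: real assume "0 < \<epsilon>"
  then have \<epsilon>: "0 < \<epsilon> / 2" by simp
  have fin_sub: "emeasure \<mu> S \<noteq> \<infinity>" if "S \<subseteq> \<Omega>" for S
    using emeasure_mono[OF that, of \<mu>] emeasure_compact[OF compact] by (auto simp: less_top top_unique)
  have outer: "emeasure \<mu> B = (INF V\<in>{V. open V \<and> B \<subseteq> V}. emeasure \<mu> V)"
    using haar B(1) unfolding haar_measure_def by blast
  have "\<exists>V\<in>{V. open V \<and> B \<subseteq> V}. emeasure \<mu> V < emeasure \<mu> B + ennreal (\<epsilon> / 2)"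
    by (rule INF_approx_ennreal) (use outer \<epsilon> fin_sub[OF B(2)] in auto)
  then obtain V0 where V0: "open V0" "B \<subseteq> V0" "emeasure \<mu> V0 < emeasure \<mu> B + ennreal (\<epsilon> / 2)" by blast
  define V where "V = V0 \<inter> \<Omega>"
  have V: "open V" "B \<subseteq> V" "V \<subseteq> \<Omega>" using V0 B open_Omega by (auto simp: V_def)
  have VB: "emeasure \<mu> V < emeasure \<mu> B + ennreal (\<epsilon> / 2)"
    using emeasure_mono[of V V0 \<mu>] V0 by (auto simp: V_def)
  have inner: "emeasure \<mu> V = (SUP K\<in>{K. compact K \<and> K \<subseteq> V}. emeasure \<mu> K)"
    using haar V(1) unfolding haar_measure_def by blast
  have "\<exists>K\<in>{K. compact K \<and> K \<subseteq> V}. emeasure \<mu> V < emeasure \<mu> K + ennreal (\<epsilon> / 2)"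
    by (rule SUP_approx_ennreal) (use inner \<epsilon> fin_sub[OF V(3)] in \<open>auto intro: exI[of _ "{}"]\<close>)
  then obtain K where K: "compact K" "K \<subseteq> V" "emeasure \<mu> V < emeasure \<mu> K + ennreal (\<epsilon> / 2)" by blast
  obtain n where n: "\<And>x. x \<in> K \<Longrightarrow> coset x (U n) \<subseteq> V"
    using uniform_coset_neighbourhood[OF K(1) V(1) K(2)] by blast
  obtain A where A: "finite A" "A \<subseteq> K" "K \<subseteq> (\<Union>a\<in>A. coset a (U n))"
    "\<And>a b. a \<in> A \<Longrightarrow> b \<in> A \<Longrightarrow> a - b \<in> U n \<Longrightarrow> a = b"
    using finite_transversal[OF open_subgroup_U K(1), of n] by metis
  define C where "C = (\<Union>a\<in>A. coset a (U n))"
  have C: "open C" "K \<subseteq> C" "C \<subseteq> V"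
    unfolding C_def using A(2,3) n open_coset[OF open_subgroup_U] by blast+
  have "indicator C = (\<Sum>a\<in>A. indicator (coset a (U n)) :: 'a \<Rightarrow> complex)"
    unfolding C_def using union_of_cosets_indicator[OF open_subgroup_U A(1,4)]
    by (auto simp: fun_eq_iff sum_fun_apply)
  also have "\<dots> \<in> fun_space.span coset_indicators"
    using A(2) K(2) V(3) by (intro fun_space.span_sum fun_space.span_base) (auto simp: coset_indicators_def)
  finally have "indicator C \<in> L2_closure \<nu> coset_indicators"
    by (rule L2_closure_span[OF coset_indicators_sqint])
  moreover have "sqnorm \<nu> (indicator B - indicator C) < \<epsilon>"
  proof -
    have [measurable]: "V \<in> sets borel" "C \<in> sets borel" using V C by auto
    have fm: "emeasure \<mu> S = ennreal (measure \<mu> S)" if "S \<subseteq> \<Omega>" for S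
      using fin_sub[OF that] by (simp add: emeasure_eq_ennreal_measure)
    have "measure \<mu> V < measure \<mu> B + \<epsilon> / 2"
      using VB fm[OF V(3)] fm[OF B(2)] \<epsilon> by (simp add: ennreal_less_iff flip: ennreal_plus)
    then have 1: "measure \<mu> (V - B) < \<epsilon> / 2"
      using measure_Diff[of \<mu> V B] fin_sub[OF V(3)] V(2) by auto
    have "emeasure \<mu> K \<le> emeasure \<mu> C" using C by (intro emeasure_mono) auto
    then have "emeasure \<mu> V < emeasure \<mu> C + ennreal (\<epsilon> / 2)"
      using K(3) by (meson add_right_mono order_less_le_trans)
    then have "measure \<mu> V < measure \<mu> C + \<epsilon> / 2"
      using fm[OF V(3)] fm[of C] C(3) V(3) \<epsilon> by (simp add: ennreal_less_iff flip: ennreal_plus)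
    then have 2: "measure \<mu> (V - C) < \<epsilon> / 2"
      using measure_Diff[of \<mu> V C] fin_sub[OF V(3)] C(3) by auto
    have i: "integrable \<mu> (indicator (V - B) :: 'a \<Rightarrow> real)" "integrable \<mu> (indicator (V - C) :: 'a \<Rightarrow> real)"
      by (intro integrable_real_indicator; use fin_sub[of "V - B"] fin_sub[of "V - C"] V(3) in
          \<open>auto simp: less_top[symmetric]\<close>)+
    have le: "indicator \<Omega> x *\<^sub>R (cmod ((indicator B - indicator C) x))\<^sup>2 \<le> indicator (V - B) x + indicator (V - C) x" for x
      using V(2) C(3) by (auto simp: indicator_def)
    have "sqnorm \<nu> (indicator B - indicator C) \<le> (\<integral>x. indicator (V - B) x + indicator (V - C) x \<partial>\<mu>)"
      unfolding sqnorm_def integral_nu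
    proof (rule integral_mono)
      show "integrable \<mu> (\<lambda>x. indicator \<Omega> x *\<^sub>R (cmod ((indicator B - indicator C) x))\<^sup>2)"
      proof (rule Bochner_Integration.integrable_bound)
        show "integrable \<mu> (\<lambda>x. indicator (V - B) x + indicator (V - C) x :: real)" using i by simp
        show "(\<lambda>x. indicator \<Omega> x *\<^sub>R (cmod ((indicator B - indicator C) x))\<^sup>2) \<in> borel_measurable \<mu>"
          unfolding fun_diff_def by measurable
        show "AE x in \<mu>. norm (indicator \<Omega> x *\<^sub>R (cmod ((indicator B - indicator C) x))\<^sup>2)
            \<le> norm (indicator (V - B) x + indicator (V - C) x :: real)"
          by (rule AE_I2) (use V(2) C(3) in \<open>auto simp: indicator_def\<close>)
      qed
    qed (use i le in auto)
    also have "\<dots> = measure \<mu> (V - B) + measure \<mu> (V - C)" using i by simp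
    finally show ?thesis using 1 2 by simp
  qed
  ultimately show "\<exists>h\<in>L2_closure \<nu> coset_indicators. sqnorm \<nu> (indicator B - h) < \<epsilon>" by blast
qed

lemma complete_coset_indicators: "complete_in_L2 \<nu> coset_indicators"
proof (rule complete_in_L2_indicatorI[OF finite_measure_nu coset_indicators_sqint])
  fix B assume "B \<in> sets \<nu>"
  then show "indicator B \<in> L2_closure \<nu> coset_indicators"
    by (intro indicator_in_closure) (auto simp: sets_restrict_space)
qed

lemma countable_coset_indicators: "countable coset_indicators"
proof -
  have fin: "finite ((\<lambda>a. coset a (U n)) ` \<Omega>)" for n
  proof -
    obtain A where A: "finite A" "\<Omega> \<subseteq> (\<Union>a\<in>A. coset a (U n))"
      using finite_transversal[OF open_subgroup_U compact] by metis
    have "(\<lambda>a. coset a (U n)) ` \<Omega> \<subseteq> (\<lambda>a. coset a (U n)) ` A"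
    proof (rule image_subsetI)
      fix x assume "x \<in> \<Omega>"
      then obtain a where "a \<in> A" "x \<in> coset a (U n)" using A(2) by blast
      then show "coset x (U n) \<in> (\<lambda>a. coset a (U n)) ` A"
        using mem_coset_imp_eq[OF open_subgroup_U] by blast
    qed
    then show ?thesis using A(1) finite_subset by blast
  qed
  have "countable (\<Union>n. (\<lambda>a. coset a (U n)) ` \<Omega>)"
    by (rule countable_UN) (simp_all only: countable_finite[OF fin] countableI_type)
  then have "countable (indicator ` (\<Union>n. (\<lambda>a. coset a (U n)) ` \<Omega>) :: ('a \<Rightarrow> complex) set)"
    by (rule countable_image)
  moreover have "coset_indicators = indicator ` (\<Union>n. (\<lambda>a. coset a (U n)) ` \<Omega>)"
    by (auto simp: coset_indicators_def)
  ultimately show ?thesis by simp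
qed

text \<open>Only countably many cosets of the subgroups \<open>U n\<close> meet \<open>\<Omega>\<close>, and finitely many characters
  suffice for each of their indicators. This is why the Riesz basis is countable.\<close>

lemma countable_spanning_characters:
  obtains \<Gamma> where "countable \<Gamma>" "\<Gamma> \<subseteq> characters" "coset_indicators \<subseteq> span_on \<Omega> \<Gamma>"
proof -
  have "\<exists>t. finite t \<and> t \<subseteq> characters \<and> s \<in> span_on \<Omega> t" if s: "s \<in> coset_indicators" for s
  proof -
    obtain a n where an: "s = indicator (coset a (U n))" using s by (auto simp: coset_indicators_def)
    have "s \<in> span_on \<Omega> (characters_mod (U n))"
      unfolding an by (rule coset_indicator_in_span[OF open_subgroup_U compact])
    then obtain t where "finite t" "t \<subseteq> characters_mod (U n)" "s \<in> span_on \<Omega> t"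
      by (rule span_on_finite_support)
    then show ?thesis by (auto simp: characters_mod_def)
  qed
  then obtain t where t: "\<And>s. s \<in> coset_indicators \<Longrightarrow> finite (t s) \<and> t s \<subseteq> characters \<and> s \<in> span_on \<Omega> (t s)"
    by metis
  show ?thesis
  proof (rule that[of "\<Union>s\<in>coset_indicators. t s"])
    show "countable (\<Union>s\<in>coset_indicators. t s)"
      using countable_coset_indicators t by (intro countable_UN) (auto intro: countable_finite)
    show "(\<Union>s\<in>coset_indicators. t s) \<subseteq> characters" using t by blast
    show "coset_indicators \<subseteq> span_on \<Omega> (\<Union>s\<in>coset_indicators. t s)"
    proof
      fix s assume s: "s \<in> coset_indicators"
      then have "span_on \<Omega> (t s) \<subseteq> span_on \<Omega> (\<Union>s\<in>coset_indicators. t s)" by (intro span_on_mono) blast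
      then show "s \<in> span_on \<Omega> (\<Union>s\<in>coset_indicators. t s)" using t[OF s] by blast
    qed
  qed
qed

end

section \<open>The Riesz basis\<close>

text \<open>The Hilbert--Schmidt bound for the norm of a matrix.\<close>

lemma sum_cmod2_matrix_le:
  fixes p :: "'l \<Rightarrow> 'k \<Rightarrow> complex"
  shows "(\<Sum>l\<in>L. (cmod (\<Sum>k\<in>N. p l k * a k))\<^sup>2) \<le> (\<Sum>l\<in>L. \<Sum>k\<in>N. (cmod (p l k))\<^sup>2) * (\<Sum>k\<in>N. (cmod (a k))\<^sup>2)"
proof -
  have "(cmod (\<Sum>k\<in>N. p l k * a k))\<^sup>2 \<le> (\<Sum>k\<in>N. (cmod (p l k))\<^sup>2) * (\<Sum>k\<in>N. (cmod (a k))\<^sup>2)" for l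
  proof -
    have "cmod (\<Sum>k\<in>N. p l k * a k) \<le> (\<Sum>k\<in>N. cmod (p l k) * cmod (a k))"
      by (rule order_trans[OF norm_sum]) (simp add: norm_mult)
    then have "(cmod (\<Sum>k\<in>N. p l k * a k))\<^sup>2 \<le> (\<Sum>k\<in>N. cmod (p l k) * cmod (a k))\<^sup>2"
      by (intro power_mono) auto
    also have "\<dots> \<le> (\<Sum>k\<in>N. (cmod (p l k))\<^sup>2) * (\<Sum>k\<in>N. (cmod (a k))\<^sup>2)"
      by (rule Cauchy_Schwarz_ineq_sum)
    finally show ?thesis .
  qed
  then show ?thesis unfolding sum_distrib_right by (rule sum_mono)
qed

text \<open>The index set is \<open>I = X \<times> A\<close>; the pair \<open>(\<xi>, k)\<close> stands for \<open>e (\<xi>, k) = 1\<^bsub>k+H\<^esub> \<xi> / sqrt m\<close>,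
  where \<open>m\<close> is the measure of \<open>H\<close>, and for the character \<open>f (\<xi>, k) = \<xi> \<psi> k\<close>. On \<open>\<Omega>\<close> the matrices
  \<open>\<psi>\<close> and \<open>C\<close> transform the two families into each other, with \<open>\<xi>\<close> as a mere parameter.\<close>

lemma (in haar_compact_open) exists_riesz_basis_of_characters:
  "\<exists>\<Lambda>\<subseteq>characters. forms_riesz_basis \<mu> \<Omega> \<Lambda>"
proof -
  obtain n where n: "\<And>x. x \<in> \<Omega> \<Longrightarrow> coset x (U n) \<subseteq> \<Omega>"
    using uniform_coset_neighbourhood[OF compact open_Omega subset_refl] by blast
  define H where "H = U n"
  have H: "open_subgroup H" unfolding H_def by (rule open_subgroup_U)
  obtain A where A: "finite A" "A \<subseteq> \<Omega>" "\<Omega> \<subseteq> (\<Union>a\<in>A. coset a H)"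
    and A_uniq: "\<And>a b. a \<in> A \<Longrightarrow> b \<in> A \<Longrightarrow> a - b \<in> H \<Longrightarrow> a = b"
    using finite_transversal[OF H compact] by metis
  have coset_sub: "coset k H \<subseteq> \<Omega>" if "k \<in> A" for k using n that A(2) by (auto simp: H_def)
  have coset_uniq: "k = l" if "x \<in> coset k H" "x \<in> coset l H" "k \<in> A" "l \<in> A" for x k l
  proof -
    have "coset k H = coset l H"
      using mem_coset_imp_eq[OF H that(1)] mem_coset_imp_eq[OF H that(2)] by (rule trans[OF sym])
    then show ?thesis using A_uniq[OF that(3,4)] by (simp only: coset_eq_iff[OF H])
  qed

  have ind: "indicator {a} \<in> span_on A (characters_mod H)" if "a \<in> A" for a
  proof (rule span_on_cong[OF coset_indicator_in_span[OF H finite_imp_compact[OF A(1)]]])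
    fix x assume "x \<in> A"
    then show "indicator {a} x = (indicator (coset a H) x :: complex)"
      using A_uniq[of x a] \<open>a \<in> A\<close> coset_self[OF H, of a] by (auto simp: indicator_def mem_coset)
  qed
  obtain \<psi> C where \<psi>: "\<And>k. k \<in> A \<Longrightarrow> \<psi> k \<in> characters_mod H"
    and C1: "\<And>l x. l \<in> A \<Longrightarrow> x \<in> A \<Longrightarrow> (\<Sum>k\<in>A. C k l * \<psi> k x) = (if x = l then 1 else 0)"
    and C2: "\<And>k k'. k \<in> A \<Longrightarrow> k' \<in> A \<Longrightarrow> (\<Sum>l\<in>A. C k l * \<psi> k' l) = (if k = k' then 1 else 0)"
    by (rule unisolvent_subfamily[OF A(1) ind], assumption) (rule that)
  have \<psi>c: "\<psi> k \<in> characters" if "k \<in> A" for k using \<psi>[OF that] by (simp add: characters_mod_def)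

  obtain \<Gamma> where \<Gamma>: "countable \<Gamma>" "\<Gamma> \<subseteq> characters" "coset_indicators \<subseteq> span_on \<Omega> \<Gamma>"
    by (rule countable_spanning_characters)
  \<comment> \<open>\<open>X\<close> selects one character from each class of elements of \<open>\<Gamma>\<close> that agree on \<open>H\<close>.\<close>
  have "(\<lambda>\<gamma>. restrict \<gamma> H) ` \<Gamma> \<subseteq> (\<lambda>\<gamma>. restrict \<gamma> H) ` \<Gamma>" by simp
  then obtain X where X: "X \<subseteq> \<Gamma>" "inj_on (\<lambda>\<gamma>. restrict \<gamma> H) X"
    "(\<lambda>\<gamma>. restrict \<gamma> H) ` \<Gamma> = (\<lambda>\<gamma>. restrict \<gamma> H) ` X"
    unfolding subset_image_inj by blast
  have Xc: "\<xi> \<in> characters" if "\<xi> \<in> X" for \<xi> using that X(1) \<Gamma>(2) by blast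
  have X_rep: "\<exists>\<xi>\<in>X. \<forall>h\<in>H. \<gamma> h = \<xi> h" if "\<gamma> \<in> \<Gamma>" for \<gamma>
  proof -
    have "restrict \<gamma> H \<in> (\<lambda>\<gamma>. restrict \<gamma> H) ` X" unfolding X(3)[symmetric] using that by (rule imageI)
    then obtain \<xi> where \<xi>: "\<xi> \<in> X" "restrict \<gamma> H = restrict \<xi> H" by blast
    have "\<gamma> h = \<xi> h" if "h \<in> H" for h using fun_cong[OF \<xi>(2), of h] that by simp
    then show ?thesis using \<xi>(1) by blast
  qed
  have X_diff: "\<exists>h\<in>H. \<xi> h \<noteq> \<xi>' h" if "\<xi> \<in> X" "\<xi>' \<in> X" "\<xi> \<noteq> \<xi>'" for \<xi> \<xi>'
  proof (rule ccontr)
    assume "\<not> (\<exists>h\<in>H. \<xi> h \<noteq> \<xi>' h)"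
    then have "restrict \<xi> H = restrict \<xi>' H" by (auto simp: restrict_def fun_eq_iff)
    with inj_onD[OF X(2)] that show False by blast
  qed

  define m where "m = measure \<mu> H"
  have m: "0 < m" if "k \<in> A" for k
  proof -
    have "emeasure \<mu> H \<le> emeasure \<mu> \<Omega>"
      using emeasure_mono[OF coset_sub[OF that], of \<mu>] by (simp add: emeasure_coset[OF H])
    then have "emeasure \<mu> H < \<infinity>" using emeasure_compact[OF compact] by (rule order_le_less_trans)
    then show ?thesis using emeasure_open_subgroup_pos[OF H]
      by (simp add: m_def measure_def enn2real_positive_iff zero_less_iff_neq_zero)
  qed

  define I where "I = X \<times> A"
  define e where "e i x = complex_of_real (1 / sqrt m) * (indicator (coset (snd i) H) x * fst i x)" for i :: "('a \<Rightarrow> complex) \<times> 'a" and x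
  define f where "f i x = fst i x * \<psi> (snd i) x" for i :: "('a \<Rightarrow> complex) \<times> 'a" and x
  have cm: "\<gamma> \<in> borel_measurable borel" if "\<gamma> \<in> characters" for \<gamma> :: "'a \<Rightarrow> complex"
    using characterD(1)[OF that] by (rule borel_measurable_continuous_onI)
  have [measurable]: "coset k H \<in> sets borel" for k using open_coset[OF H, of k] by simp

  have f_char: "f i \<in> characters" if "i \<in> I" for i
    using that character_mult[OF Xc \<psi>c] by (auto simp: I_def f_def[abs_def])
  have e_sqint: "e i \<in> square_integrable \<nu>" if "i \<in> I" for i
  proof (rule bounded_sqint[OF finite_measure_nu measurable_nu, of _ "1 / sqrt m"])
    have i: "fst i \<in> characters" "0 < m" using that Xc m by (auto simp: I_def)
    note [measurable] = cm[OF i(1)]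
    show "e i \<in> borel_measurable borel" unfolding e_def by measurable
    show "cmod (e i x) \<le> 1 / sqrt m" for x
      using i(2) by (auto simp: e_def norm_mult norm_divide characterD(2)[OF i(1)] indicator_def)
  qed
  have f_sqint: "f i \<in> square_integrable \<nu>" if "i \<in> I" for i
    by (rule bounded_sqint[OF finite_measure_nu measurable_nu, of _ 1])
       (use cm[OF f_char[OF that]] characterD(2)[OF f_char[OF that]] in auto)

  have orth: "(\<integral>x. e i x * cnj (e j x) \<partial>\<nu>) = (if i = j then 1 else 0)" if ij: "i \<in> I" "j \<in> I" for i j
  proof -
    obtain \<xi> k \<xi>' l where i: "i = (\<xi>, k)" "j = (\<xi>', l)" "\<xi> \<in> X" "\<xi>' \<in> X" "k \<in> A" "l \<in> A"
      using ij by (auto simp: I_def)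
    have mm: "complex_of_real (1 / sqrt m) * complex_of_real (1 / sqrt m) = 1 / complex_of_real m"
      using m[OF i(5)] by (simp flip: of_real_mult)
    show ?thesis
    proof (cases "k = l")
      case True
      have "(\<integral>x. e i x * cnj (e j x) \<partial>\<nu>)
          = (\<integral>x. (1 / complex_of_real m) * (indicator (coset k H) x * (\<xi> x * cnj (\<xi>' x))) \<partial>\<mu>)"
        unfolding integral_nu mm[symmetric]
        by (rule Bochner_Integration.integral_cong)
           (use coset_sub[OF i(5)] True in \<open>auto simp: e_def i indicator_def\<close>)
      also have "\<dots> = (1 / complex_of_real m) * (\<integral>x. indicator (coset k H) x * (\<xi> x * cnj (\<xi>' x)) \<partial>\<mu>)"
        by (rule integral_mult_right_zero)
      also have "\<dots> = (if i = j then 1 else 0)"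
      proof (cases "\<xi> = \<xi>'")
        case True
        then show ?thesis using character_norm[OF H Xc[OF i(3)], of k] m[OF i(5)] \<open>k = l\<close>
          by (simp add: i m_def)
      next
        case False
        then obtain h where h: "h \<in> H" "\<xi> h \<noteq> \<xi>' h" using X_diff[OF i(3,4)] by blast
        show ?thesis using character_orthogonality[OF H Xc[OF i(3)] Xc[OF i(4)] h, of k] False by (simp add: i)
      qed
      finally show ?thesis .
    next
      case False
      have "e i x * cnj (e j x) = 0" for x
        using coset_uniq[of x k l] False i(5,6) by (auto simp: e_def i(1,2) indicator_def)
      then have "(\<lambda>x. e i x * cnj (e j x)) = (\<lambda>x. 0)" by (rule ext)
      then show ?thesis using False i(1,2) by (simp only: prod.inject) simp
    qed
  qed

  have f_on_coset: "f (\<xi>, k) x = \<psi> k l * \<xi> x" if "k \<in> A" "x \<in> coset l H" for \<xi> k l x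
    using characters_mod_const_on_coset[OF \<psi>[OF that(1)] that(2)] by (simp add: f_def)

  \<comment> \<open>A member of \<open>\<Gamma>\<close> and its representative in \<open>X\<close> are proportional on each coset of \<open>H\<close>.\<close>
  have "coset_indicators \<subseteq> span_on \<Omega> (e ` I)"
  proof
    fix s assume "s \<in> coset_indicators"
    with \<Gamma>(3) have s: "s \<in> span_on \<Omega> \<Gamma>" by blast
    have "(\<lambda>x. indicator (coset k H) x * s x) \<in> span_on \<Omega> (e ` I)" if k: "k \<in> A" for k
    proof (rule span_on_mult[OF s])
      fix \<gamma> assume "\<gamma> \<in> \<Gamma>"
      then have \<gamma>: "\<gamma> \<in> characters" using \<Gamma>(2) by blast
      obtain \<xi> where \<xi>: "\<xi> \<in> X" "\<And>h. h \<in> H \<Longrightarrow> \<gamma> h = \<xi> h" using X_rep[OF \<open>\<gamma> \<in> \<Gamma>\<close>] by blast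
      have "e (\<xi>, k) \<in> span_on \<Omega> (e ` I)" by (rule span_on_base) (use \<xi>(1) k in \<open>auto simp: I_def\<close>)
      then have "(\<lambda>x. (complex_of_real (sqrt m) * \<gamma> k / \<xi> k) * e (\<xi>, k) x) \<in> span_on \<Omega> (e ` I)"
        by (rule span_on_scale)
      then show "(\<lambda>x. indicator (coset k H) x * \<gamma> x) \<in> span_on \<Omega> (e ` I)"
      proof (rule span_on_cong)
        fix x
        show "indicator (coset k H) x * \<gamma> x = (complex_of_real (sqrt m) * \<gamma> k / \<xi> k) * e (\<xi>, k) x"
        proof (cases "x \<in> coset k H")
          case True
          then have "\<gamma> (x - k) = \<xi> (x - k)" by (intro \<xi>(2)) (simp add: mem_coset)
          then have "\<gamma> x / \<gamma> k = \<xi> x / \<xi> k"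
            by (simp add: characterD(6)[OF \<gamma>] characterD(6)[OF Xc[OF \<xi>(1)]])
          then show ?thesis using True m[OF k] characterD(4)[OF \<gamma>, of k] characterD(4)[OF Xc[OF \<xi>(1)], of k]
            by (simp add: e_def field_simps)
        qed (simp add: e_def)
      qed
    qed
    then have "(\<Sum>k\<in>A. (\<lambda>x. indicator (coset k H) x * s x)) \<in> span_on \<Omega> (e ` I)" by (rule span_on_sum)
    then show "s \<in> span_on \<Omega> (e ` I)"
    proof (rule span_on_cong)
      fix x assume "x \<in> \<Omega>"
      have "(\<Sum>k\<in>A. indicator (coset k H) x :: complex) = indicator (\<Union>a\<in>A. coset a H) x"
        using union_of_cosets_indicator[OF H A(1) A_uniq] by simp
      also have "\<dots> = 1" using \<open>x \<in> \<Omega>\<close> A(3) by (intro indicator_simps(1)) blast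
      finally show "s x = (\<Sum>k\<in>A. (\<lambda>x. indicator (coset k H) x * s x)) x"
        by (simp only: sum_fun_apply flip: sum_distrib_right) simp
    qed
  qed
  then have e_complete: "complete_in_L2 \<nu> (e ` I)"
    using complete_in_L2_trans[OF complete_coset_indicators] by simp

  \<comment> \<open>The matrix \<open>C\<close> recovers the indicators of the cosets from the \<open>\<psi> k\<close>.\<close>
  have "e ` I \<subseteq> span_on \<Omega> (f ` I)"
  proof (rule image_subsetI)
    fix i assume "i \<in> I"
    then obtain \<xi> l where i: "i = (\<xi>, l)" "\<xi> \<in> X" "l \<in> A" by (auto simp: I_def)
    have "(\<Sum>k\<in>A. (\<lambda>x. (complex_of_real (1 / sqrt m) * C k l) * f (\<xi>, k) x)) \<in> span_on \<Omega> (f ` I)"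
      by (intro span_on_sum span_on_scale span_on_base) (use i in \<open>auto simp: I_def\<close>)
    then show "e i \<in> span_on \<Omega> (f ` I)"
    proof (rule span_on_cong)
      fix x assume "x \<in> \<Omega>"
      then obtain a where a: "a \<in> A" "x \<in> coset a H" using A(3) by blast
      have "(\<Sum>k\<in>A. (complex_of_real (1 / sqrt m) * C k l) * f (\<xi>, k) x)
          = (\<Sum>k\<in>A. (complex_of_real (1 / sqrt m) * \<xi> x) * (C k l * \<psi> k a))"
        by (rule sum.cong) (simp_all add: f_on_coset[OF _ a(2)])
      also have "\<dots> = complex_of_real (1 / sqrt m) * \<xi> x * (if a = l then 1 else 0)"
        by (simp only: sum_distrib_left[symmetric] C1[OF i(3) a(1)])
      also have "\<dots> = e i x"
        using a(2) coset_uniq[OF a(2) _ a(1) i(3)] by (auto simp: e_def i(1) indicator_def)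
      finally show "e i x = (\<Sum>k\<in>A. (\<lambda>x. (complex_of_real (1 / sqrt m) * C k l) * f (\<xi>, k) x)) x"
        by (simp add: sum_fun_apply)
    qed
  qed
  then have f_complete: "complete_in_L2 \<nu> (f ` I)"
    using complete_in_L2_trans[OF e_complete] by simp

  \<comment> \<open>The norms of both matrices, scaled by the measure of \<open>H\<close>, bound the Riesz constant; \<open>K\<close> is the
    sum, which dominates both.\<close>
  define P where "P = (\<Sum>l\<in>A. \<Sum>k\<in>A. (cmod (\<psi> k l))\<^sup>2)"
  define Q where "Q = (\<Sum>k\<in>A. \<Sum>l\<in>A. (cmod (C k l))\<^sup>2)"
  have PQ: "0 \<le> P" "0 \<le> Q" by (auto simp: P_def Q_def intro!: sum_nonneg)
  define K where "K = m * P + Q / m"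
  have m0: "0 \<le> m" by (simp add: m_def)
  have "0 \<le> K" using PQ m0 by (simp add: K_def)

  have bounds: "sqnorm \<nu> (lincomb F a f) \<le> K * (\<Sum>i\<in>F. (cmod (a i))\<^sup>2)
      \<and> (\<Sum>i\<in>F. (cmod (a i))\<^sup>2) \<le> K * sqnorm \<nu> (lincomb F a f)"
    if F: "finite F" "F \<subseteq> I" for F a
  proof (cases "F = {}")
    case False
    then have mpos: "0 < m" using F(2) m by (auto simp: I_def)
    \<comment> \<open>After extension of the coefficients by 0, the sum runs over a product set, on which the matrix
      acts separately for each \<open>\<xi>\<close>: \<open>\<beta> \<xi> l\<close> is the coefficient of \<open>\<xi>\<close> on the coset \<open>l + H\<close>.\<close>
    define Y where "Y = fst ` F"
    have Y: "finite Y" "Y \<subseteq> X" "F \<subseteq> Y \<times> A" using F by (force simp: Y_def I_def)+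
    define c where "c i = (if i \<in> F then a i else 0)" for i
    have lc: "lincomb F a f = lincomb (Y \<times> A) c f"
      unfolding c_def by (rule lincomb_extend) (use Y A(1) in auto)
    have sc: "(\<Sum>i\<in>F. (cmod (a i))\<^sup>2) = (\<Sum>\<xi>\<in>Y. \<Sum>k\<in>A. (cmod (c (\<xi>, k)))\<^sup>2)"
    proof -
      have "(\<Sum>i\<in>F. (cmod (a i))\<^sup>2) = (\<Sum>i\<in>Y \<times> A. (cmod (c i))\<^sup>2)"
        by (rule sum.mono_neutral_cong_left) (use Y A(1) in \<open>auto simp: c_def\<close>)
      then show ?thesis by (simp add: sum.cartesian_product)
    qed
    define \<beta> where "\<beta> \<xi> l = (\<Sum>k\<in>A. \<psi> k l * c (\<xi>, k))" for \<xi> l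
    define b where "b i = complex_of_real (sqrt m) * \<beta> (fst i) (snd i)" for i :: "('a \<Rightarrow> complex) \<times> 'a"
    have "sqnorm \<nu> (lincomb (Y \<times> A) c f) = sqnorm \<nu> (lincomb (Y \<times> A) b e)"
    proof (rule sqnorm_cong)
      fix x assume "x \<in> space \<nu>"
      then obtain l where l: "l \<in> A" "x \<in> coset l H" using A(3) by auto
      have "lincomb (Y \<times> A) c f x = (\<Sum>\<xi>\<in>Y. \<Sum>k\<in>A. c (\<xi>, k) * f (\<xi>, k) x)"
        by (simp add: sum_fun_apply sum.cartesian_product)
      also have "\<dots> = (\<Sum>\<xi>\<in>Y. \<beta> \<xi> l * \<xi> x)"
        unfolding \<beta>_def sum_distrib_right
        by (intro sum.cong refl) (simp add: f_on_coset[OF _ l(2)])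
      also have "\<dots> = (\<Sum>\<xi>\<in>Y. \<Sum>k\<in>A. if k = l then \<beta> \<xi> l * \<xi> x else 0)"
        using A(1) l(1) by simp
      also have "\<dots> = (\<Sum>\<xi>\<in>Y. \<Sum>k\<in>A. b (\<xi>, k) * e (\<xi>, k) x)"
      proof (intro sum.cong refl)
        fix \<xi> k assume "\<xi> \<in> Y" "k \<in> A"
        show "(if k = l then \<beta> \<xi> l * \<xi> x else 0) = b (\<xi>, k) * e (\<xi>, k) x"
        proof (cases "k = l")
          case True
          then show ?thesis using l(2) mpos by (simp add: b_def e_def)
        next
          case False
          then have "x \<notin> coset k H" using coset_uniq[OF l(2) _ l(1) \<open>k \<in> A\<close>] by blast
          then show ?thesis using False by (simp add: e_def)
        qed
      qed
      also have "\<dots> = lincomb (Y \<times> A) b e x"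
        by (simp add: sum_fun_apply sum.cartesian_product)
      finally show "lincomb (Y \<times> A) c f x = lincomb (Y \<times> A) b e x" .
    qed
    also have "\<dots> = (\<Sum>i\<in>Y \<times> A. (cmod (b i))\<^sup>2)"
    proof (rule sqnorm_orthonormal_sum)
      have "Y \<times> A \<subseteq> I" using Y(2) by (auto simp: I_def)
      then show "e i \<in> square_integrable \<nu>" "(\<integral>x. e i x * cnj (e j x) \<partial>\<nu>) = (if i = j then 1 else 0)"
        if "i \<in> Y \<times> A" "j \<in> Y \<times> A" for i j using that by (blast intro: e_sqint, intro orth) blast+
      show "finite (Y \<times> A)" using Y(1) A(1) by simp
    qed
    also have "\<dots> = m * (\<Sum>\<xi>\<in>Y. \<Sum>l\<in>A. (cmod (\<beta> \<xi> l))\<^sup>2)"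
      using m0 by (simp add: b_def norm_mult power_mult_distrib sum_distrib_left sum.cartesian_product split_def)
    finally have sq: "sqnorm \<nu> (lincomb F a f) = m * (\<Sum>\<xi>\<in>Y. \<Sum>l\<in>A. (cmod (\<beta> \<xi> l))\<^sup>2)" using lc by simp

    have up: "(\<Sum>\<xi>\<in>Y. \<Sum>l\<in>A. (cmod (\<beta> \<xi> l))\<^sup>2) \<le> P * (\<Sum>i\<in>F. (cmod (a i))\<^sup>2)"
      unfolding sc P_def \<beta>_def
      by (subst sum_distrib_left, rule sum_mono) (rule sum_cmod2_matrix_le)
    have inv: "c (\<xi>, k) = (\<Sum>l\<in>A. C k l * \<beta> \<xi> l)" if "k \<in> A" for \<xi> k
    proof -
      have "(\<Sum>l\<in>A. C k l * \<beta> \<xi> l) = (\<Sum>l\<in>A. \<Sum>k'\<in>A. (C k l * \<psi> k' l) * c (\<xi>, k'))"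
        by (simp add: \<beta>_def sum_distrib_left mult.assoc)
      also have "\<dots> = (\<Sum>k'\<in>A. \<Sum>l\<in>A. (C k l * \<psi> k' l) * c (\<xi>, k'))" by (rule sum.swap)
      also have "\<dots> = (\<Sum>k'\<in>A. (if k = k' then 1 else 0) * c (\<xi>, k'))"
        by (intro sum.cong refl) (simp only: sum_distrib_right[symmetric] C2[OF that])
      also have "\<dots> = c (\<xi>, k)" using A(1) that by (simp add: if_distrib[of "\<lambda>z. z * _"] cong: if_cong)
      finally show ?thesis ..
    qed
    have low: "(\<Sum>i\<in>F. (cmod (a i))\<^sup>2) \<le> Q * (\<Sum>\<xi>\<in>Y. \<Sum>l\<in>A. (cmod (\<beta> \<xi> l))\<^sup>2)"
    proof -
      have "(\<Sum>k\<in>A. (cmod (c (\<xi>, k)))\<^sup>2) \<le> Q * (\<Sum>l\<in>A. (cmod (\<beta> \<xi> l))\<^sup>2)" for \<xi>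
      proof -
        have "(\<Sum>k\<in>A. (cmod (c (\<xi>, k)))\<^sup>2) = (\<Sum>k\<in>A. (cmod (\<Sum>l\<in>A. C k l * \<beta> \<xi> l))\<^sup>2)"
          by (intro sum.cong refl) (simp only: inv)
        also have "\<dots> \<le> Q * (\<Sum>l\<in>A. (cmod (\<beta> \<xi> l))\<^sup>2)" unfolding Q_def by (rule sum_cmod2_matrix_le)
        finally show ?thesis .
      qed
      then show ?thesis unfolding sc by (subst sum_distrib_left) (rule sum_mono)
    qed
    define S where "S = (\<Sum>\<xi>\<in>Y. \<Sum>l\<in>A. (cmod (\<beta> \<xi> l))\<^sup>2)"
    define R where "R = (\<Sum>i\<in>F. (cmod (a i))\<^sup>2)"
    have SR: "0 \<le> S" "0 \<le> R" "S \<le> P * R" "R \<le> Q * S"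
      using up low by (auto simp: S_def R_def intro!: sum_nonneg)
    have "m * S \<le> m * (P * R)" using SR(3) m0 by (rule mult_left_mono)
    also have "\<dots> \<le> K * R" using SR PQ mpos by (simp add: K_def distrib_right)
    finally have 1: "m * S \<le> K * R" .
    have "R \<le> (Q / m) * (m * S)" using SR(4) mpos by simp
    also have "\<dots> \<le> K * (m * S)"
      using SR PQ mpos by (intro mult_right_mono) (auto simp: K_def)
    finally have 2: "R \<le> K * (m * S)" .
    show ?thesis unfolding sq S_def[symmetric] R_def[symmetric] using 1 2 by simp
  qed simp

  have "riesz_basis (L2 \<nu>) I (\<lambda>i. L2_class \<nu> (f i))"
  proof (rule riesz_basis_L2I[OF _ e_sqint orth e_complete f_sqint f_complete \<open>0 \<le> K\<close>])
    show "countable I" unfolding I_def using X(1) \<Gamma>(1) A(1)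
      by (intro countable_SIGMA) (auto intro: countable_subset countable_finite)
  qed (use bounds in blast)+
  moreover have "inj_on f I"
  proof (rule inj_onI)
    fix i j assume ij: "i \<in> I" "j \<in> I" "f i = f j"
    obtain \<xi> k \<xi>' k' where i: "i = (\<xi>, k)" "j = (\<xi>', k')" "\<xi> \<in> X" "\<xi>' \<in> X" "k \<in> A" "k' \<in> A"
      using ij by (auto simp: I_def)
    have eq: "\<xi> x * \<psi> k x = \<xi>' x * \<psi> k' x" for x using fun_cong[OF ij(3), of x] by (simp add: f_def i)
    have "\<xi> h = \<xi>' h" if "h \<in> H" for h
      using eq[of h] \<psi>[OF i(5)] \<psi>[OF i(6)] that by (simp add: characters_mod_def)
    then have "\<xi> = \<xi>'" using X_diff[OF i(3,4)] by blast
    then have "\<psi> k x = \<psi> k' x" for x using eq[of x] characterD(4)[OF Xc[OF i(3)], of x] by simp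
    then have "(\<Sum>l\<in>A. C k l * \<psi> k l) = (\<Sum>l\<in>A. C k l * \<psi> k' l)" by simp
    then have "k = k'" using C2[OF i(5,5)] C2[OF i(5,6)] by (auto split: if_splits)
    with \<open>\<xi> = \<xi>'\<close> show "i = j" by (simp add: i)
  qed
  ultimately have "riesz_basis (L2 \<nu>) (f ` I) (L2_class \<nu>)"
    by (intro riesz_basis_reindex)
  then have "forms_riesz_basis \<mu> \<Omega> (f ` I)" by (simp add: forms_riesz_basis_def)
  moreover have "f ` I \<subseteq> characters" using f_char by blast
  ultimately show ?thesis by blast
qed

theorem theorem1p1:
  fixes \<mu> :: "'a::topological_ab_group_add measure"
    and \<Omega> :: "'a set"
  assumes "polish_group TYPE('a)"
    and "locally_compact_abelian_group TYPE('a)"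
    and "non_archimedean_group TYPE('a)"
    and "haar_measure \<mu>"
    and "compact \<Omega>" and "open \<Omega>"
  shows "\<exists>\<Lambda> \<subseteq> characters. forms_riesz_basis \<mu> \<Omega> \<Lambda>"
proof -
  obtain U :: "nat \<Rightarrow> 'a set" where U: "filtered_group U"
    using non_archimedean_filtration[OF assms(3)] by blast
  interpret filtered_group U by (rule U)
  interpret haar_compact_open U \<mu> \<Omega>
    by unfold_locales (rule assms(4-6))+
  show ?thesis by (rule exists_riesz_basis_of_characters)
qed

end
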